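(* Assume $Y\sim\mathrm{N}(1_n\beta,\Sigma)$ with $\Sigma=\Sigma(\psi)=\sum_{j=1}^{r-1}\psi_jn_{(j)}\mathcal{P}_j+\psi_rI_n$ (the model with $r-1$ crossed random effects). If $r\geq3$ and $n_{\min}\geq2$, then for every $v\in\mathbb{S}^{r-1}$ and $\psi\in\mathbb{P}=[0,\infty)^{r-1}\times(0,\infty)$, \[ a(v,\psi)^2\leq\sum_{j=1}^{r-1}\frac{1}{n_j-1}+\frac{(r-2)^2}{\tilde n}\leq\frac{r-1}{n_{\min}-1}+\frac{(r-2)^2}{\tilde n}. \] Moreover, if also $n_{\min}\geq3$, then \[ \tilde a(v,\psi)^2\leq\max\left\{(n_{\min}-2)^{-1},(\tilde n-1)^{-1}\right\}. \]
   Context: Model: $n_1,\dots,n_{r-1}$ are positive integers, $n=\prod_{i=1}^{r-1}n_i$, $n_{(j)}=\prod_{i\ne j}n_i$, $n_{\min}=\min_{1\leq j\leq r-1}n_j$, $\tilde n=n-1-\sum_{j=1}^{r-1}(n_j-1)$. $1_k\in\mathbb{R}^k$ is the vector of ones, $P_j=1_{n_j}1_{n_j}^{\mathsf T}/n_j$, and $\mathcal{P}_j=P_1\otimes\cdots\otimes P_{j-1}\otimes I_{n_j}\otimes P_{j+1}\otimes\cdots\otimes P_{r-1}$. With $Z^{(j)}=1_{n_1}\otimes\cdots\otimes1_{n_{j-1}}\otimes I_{n_j}\otimes1_{n_{j+1}}\otimes\cdots\otimes1_{n_{r-1}}$ one has $Z^{(j)}Z^{(j)\mathsf T}=n_{(j)}\mathcal{P}_j$,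 so this is the linear mixed model $Y=1_n\beta+ZU+E$ with $\beta\in\mathbb{R}$, $Z=[Z^{(1)},\dots,Z^{(r-1)}]$, independent $U\sim\mathrm{N}(0,\Psi)$ and $E\sim\mathrm{N}(0,\psi_rI_n)$, $\Psi$ block-diagonal with blocks $\psi_1I_{n_1},\dots,\psi_{r-1}I_{n_{r-1}}$. For any $v\in\mathbb{R}^r$, $\Sigma(v)=\sum_{j=1}^{r-1}v_jn_{(j)}\mathcal{P}_j+v_rI_n$. Notation: $\|\cdot\|$ is the spectral norm of matrices (Euclidean for vectors), $\|\cdot\|_F$ the Frobenius norm; $\mathbb{S}^{r-1}$ is the unit sphere in $\mathbb{R}^r$. For $v\in\mathbb{R}^r,\psi\in\mathbb{P}$: $A(v,\psi)=\Sigma(\psi)^{-1/2}\Sigma(v)\Sigma(\psi)^{-1/2}$, and $a(v,\psi)=\|A(v,\psi)\|/\|A(v,\psi)\|_F$ if $\|A(v,\psi)\|_F>0$, $a(v,\psi)=1$ otherwise. Restricted-likelihood version: let $V\in\mathbb{R}^{n\times(n-1)}$ be semi-orthogonal ($V^{\mathsf T}V=I_{n-1}$) with $V^{\mathsf T}1_n=0$, and for any $v\in\mathbb{R}^r$ let $\tilde\Sigma(v)=V^{\mathsf T}\Sigma(v)V$. Then $\tilde A(v,\psi)=\tilde\Sigma(\psi)^{-1/2}\tilde\Sigma(v)\tilde\Sigma(\psi)^{-1/2}$ and $\tilde a(v,\psi)=\|\tilde A(v,\psi)\|/\|\tilde A(v,\psi)\|_F$ if $\|\tilde A(v,\psi)\|_F>0$,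 $\tilde a(v,\psi)=1$ otherwise. *)

theory Defs
  imports
    "HOL-Probability.Probability"
    "Jordan_Normal_Form.Matrix"
    "Jordan_Normal_Form.Gauss_Jordan_Elimination"
begin

(* Both HOL-Analysis and Jordan_Normal_Form use these symbols; only the latter's are wanted. *)
unbundle no inner_syntax and no vec_syntax

hide_type (open) Finite_Cartesian_Product.vec

section \<open>Norms, square roots and Kronecker products of real matrices\<close>

definition vec_norm :: "real vec \<Rightarrow> real" where
  "vec_norm x = sqrt (x \<bullet> x)"

definition spectral_norm :: "real mat \<Rightarrow> real" where
  "spectral_norm A = Sup {vec_norm (A *\<^sub>v x) | x. x \<in> carrier_vec (dim_col A) \<and> vec_norm x \<le> 1}"

definition frobenius_norm :: "real mat \<Rightarrow> real" where
  "frobenius_norm A = sqrt (\<Sum>i<dim_row A. \<Sum>k<dim_col A. (A $$ (i, k))\<^sup>2)"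

definition pos_semidef :: "nat \<Rightarrow> real mat \<Rightarrow> bool" where
  "pos_semidef N A \<longleftrightarrow> A \<in> carrier_mat N N \<and> transpose_mat A = A \<and>
     (\<forall>x\<in>carrier_vec N. 0 \<le> x \<bullet> (A *\<^sub>v x))"

(* Only meaningful for positive semidefinite A, where the root exists and is unique. *)
definition sqrt_mat :: "real mat \<Rightarrow> real mat" where
  "sqrt_mat A = (THE B. pos_semidef (dim_row A) B \<and> B * B = A)"

(* A^(-1/2); only meaningful for positive definite A. *)
definition inv_sqrt_mat :: "real mat \<Rightarrow> real mat" where
  "inv_sqrt_mat A = the (mat_inverse (sqrt_mat A))"

definition kronecker :: "real mat \<Rightarrow> real mat \<Rightarrow> real mat" where
  "kronecker A B = mat (dim_row A * dim_row B) (dim_col A * dim_col B)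
     (\<lambda>(i, k). A $$ (i div dim_row B, k div dim_col B) * B $$ (i mod dim_row B, k mod dim_col B))"

definition kronecker_list :: "real mat list \<Rightarrow> real mat" where
  "kronecker_list As = foldr kronecker As (1\<^sub>m 1)"

definition ones_vec :: "nat \<Rightarrow> real vec" where
  "ones_vec k = vec k (\<lambda>_. 1)"

(* ones_vec k * (ones_vec k)^T / k, the orthogonal projection onto the span of ones_vec k *)
definition mean_mat :: "nat \<Rightarrow> real mat" where
  "mean_mat k = mat k k (\<lambda>_. 1 / real k)"


section \<open>Multivariate normal distribution\<close>

(* Y ~ N(\<mu>, S): every linear form of Y is univariate normal with the right mean and variance,
   a normal distribution of variance 0 being a point mass. *)
definition multivariate_normal ::
    "'w measure \<Rightarrow> nat \<Rightarrow> ('w \<Rightarrow> real vec) \<Rightarrow> real vec \<Rightarrow> real mat \<Rightarrow> bool" where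
  "multivariate_normal M N Y \<mu> S \<longleftrightarrow>
     prob_space M \<and> Y \<in> space M \<rightarrow> carrier_vec N \<and> \<mu> \<in> carrier_vec N \<and> pos_semidef N S \<and>
     (\<forall>t\<in>carrier_vec N.
        (\<lambda>\<omega>. t \<bullet> Y \<omega>) \<in> borel_measurable M \<and>
        (if t \<bullet> (S *\<^sub>v t) = 0 then AE \<omega> in M. t \<bullet> Y \<omega> = t \<bullet> \<mu>
         else distributed M lborel (\<lambda>\<omega>. t \<bullet> Y \<omega>)
                (\<lambda>x. ennreal (normal_density (t \<bullet> \<mu>) (sqrt (t \<bullet> (S *\<^sub>v t))) x))))"


section \<open>Crossed random effects\<close>

(* Indices are shifted to start at 0: the factor sizes are n 0, ..., n (r - 2), the variance
   parameter of factor j is the j-th entry of a vector of dimension r, and the error variance is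
   its entry r - 1. *)

definition n_total :: "nat \<Rightarrow> (nat \<Rightarrow> nat) \<Rightarrow> nat" where
  "n_total r n = (\<Prod>j<r - 1. n j)"

definition n_except :: "nat \<Rightarrow> (nat \<Rightarrow> nat) \<Rightarrow> nat \<Rightarrow> nat" where
  "n_except r n j = (\<Prod>i\<in>{..<r - 1} - {j}. n i)"

definition n_min :: "nat \<Rightarrow> (nat \<Rightarrow> nat) \<Rightarrow> nat" where
  "n_min r n = Min (n ` {..<r - 1})"

definition n_tilde :: "nat \<Rightarrow> (nat \<Rightarrow> nat) \<Rightarrow> real" where
  "n_tilde r n = real (n_total r n) - 1 - (\<Sum>j<r - 1. real (n j) - 1)"

definition proj_mat :: "nat \<Rightarrow> (nat \<Rightarrow> nat) \<Rightarrow> nat \<Rightarrow> real mat" where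
  "proj_mat r n j =
     kronecker_list (map (\<lambda>i. if i = j then 1\<^sub>m (n i) else mean_mat (n i)) [0..<r - 1])"

definition Sigma_mat :: "nat \<Rightarrow> (nat \<Rightarrow> nat) \<Rightarrow> real vec \<Rightarrow> real mat" where
  "Sigma_mat r n v =
     foldr (+) (map (\<lambda>j. (v $ j * real (n_except r n j)) \<cdot>\<^sub>m proj_mat r n j) [0..<r - 1])
       (v $ (r - 1) \<cdot>\<^sub>m 1\<^sub>m (n_total r n))"

definition param_space :: "nat \<Rightarrow> real vec set" where
  "param_space r = {\<psi>\<in>carrier_vec r. (\<forall>j<r - 1. 0 \<le> \<psi> $ j) \<and> 0 < \<psi> $ (r - 1)}"

definition unit_sphere :: "nat \<Rightarrow> real vec set" where
  "unit_sphere r = {v\<in>carrier_vec r. vec_norm v = 1}"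

definition norm_ratio :: "real mat \<Rightarrow> real" where
  "norm_ratio A = (if frobenius_norm A > 0 then spectral_norm A / frobenius_norm A else 1)"

definition A_mat :: "nat \<Rightarrow> (nat \<Rightarrow> nat) \<Rightarrow> real vec \<Rightarrow> real vec \<Rightarrow> real mat" where
  "A_mat r n v \<psi> =
     inv_sqrt_mat (Sigma_mat r n \<psi>) * Sigma_mat r n v * inv_sqrt_mat (Sigma_mat r n \<psi>)"

definition a_ratio :: "nat \<Rightarrow> (nat \<Rightarrow> nat) \<Rightarrow> real vec \<Rightarrow> real vec \<Rightarrow> real" where
  "a_ratio r n v \<psi> = norm_ratio (A_mat r n v \<psi>)"

definition contrast_basis :: "nat \<Rightarrow> real mat \<Rightarrow> bool" where
  "contrast_basis N V \<longleftrightarrow> V \<in> carrier_mat N (N - 1) \<and>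
     transpose_mat V * V = 1\<^sub>m (N - 1) \<and> transpose_mat V *\<^sub>v ones_vec N = 0\<^sub>v (N - 1)"

definition Sigma_tilde :: "nat \<Rightarrow> (nat \<Rightarrow> nat) \<Rightarrow> real mat \<Rightarrow> real vec \<Rightarrow> real mat" where
  "Sigma_tilde r n V v = transpose_mat V * Sigma_mat r n v * V"

definition A_tilde :: "nat \<Rightarrow> (nat \<Rightarrow> nat) \<Rightarrow> real mat \<Rightarrow> real vec \<Rightarrow> real vec \<Rightarrow> real mat" where
  "A_tilde r n V v \<psi> =
     inv_sqrt_mat (Sigma_tilde r n V \<psi>) * Sigma_tilde r n V v * inv_sqrt_mat (Sigma_tilde r n V \<psi>)"

definition a_tilde :: "nat \<Rightarrow> (nat \<Rightarrow> nat) \<Rightarrow> real mat \<Rightarrow> real vec \<Rightarrow> real vec \<Rightarrow> real" where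
  "a_tilde r n V v \<psi> = norm_ratio (A_tilde r n V v \<psi>)"

end

theory Submission
  imports Defs "Jordan_Normal_Form.Determinant"
begin

text \<open>
  All matrices \<Sigma>(v) of a crossed design commute: they are linear combinations of one fixed family
  of mutually orthogonal projections, so both norm ratios only depend on eigenvalues and their
  multiplicities. Let J be the projection onto the constant vectors. Distinct averaging projections
  multiply to P_j P_k = J (\<open>proj_mat_mult\<close>, factor by factor in the Kronecker product), so the main
  effects P_j - J, the grand mean J and the residual I - J - \<Sum>_j (P_j - J) are orthogonal projections
  that add up to I. Their traces are n_j - 1, 1 and n_tilde (\<open>mat_trace_crossed_proj\<close>). The eigenvalues
  of \<Sigma>(v) on them are, with e the error parameter and c_j = v_j n_(j): c_j + e on a main effect, e on
  the residual and \<Sum>_j c_j + e on the mean (\<open>Sigma_mat_eq_comb\<close>).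

  Functions of such combinations act on the coefficients. Hence A(v, \<psi>) is the combination whose
  coefficients f are the quotients of the eigenvalues of \<Sigma>(v) and \<Sigma>(\<psi>) (\<open>standardized_comb\<close>, which
  rests on the uniqueness of positive square roots), its squared Frobenius norm F is the sum of
  f_k^2 weighted by the traces, and its spectral norm is at most max |f_k|. Dividing, a^2 \<le> c follows
  once f_k^2 \<le> c F for every k (\<open>norm_ratio_comb_le\<close>). Here F > 0, because v \<noteq> 0 makes some eigenvalue
  nonzero.

  A main effect or the residual has f_k^2 \<le> F / d_k with d_k its trace. The grand mean has multiplicity
  one, so this argument gives nothing for it. Its eigenvalue is however the sum of the main-effect
  eigenvalues minus r - 2 times the residual one, for v as for \<psi>. Since the eigenvalues of \<Sigma>(\<psi>) are
  at most the one on the mean, f_r is a combination of the other quotients with coefficients in [0, 1]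
  on main effects and of modulus at most r - 2 on the residual, and Cauchy-Schwarz with weights d_k
  yields exactly the first bound (\<open>mean_ratio_square_le\<close>).

  Passing to contrasts compresses every projection by V, where V V^T = I - J. This kills J and keeps the
  remaining projections orthogonal, with unchanged traces (\<open>contrasts\<close>). Only eigenvalues of
  multiplicity n_j - 1 or n_tilde are left, and these are at least n_min - 2 and n_tilde - 1.
\<close>

section \<open>Entries and traces\<close>

lemma index_mult_mat_sum:
  fixes A B :: "real mat"
  assumes "A \<in> carrier_mat p q" "B \<in> carrier_mat q s" "i < p" "j < s"
  shows "(A * B) $$ (i, j) = (\<Sum>t<q. A $$ (i, t) * B $$ (t, j))"
  using assms by (simp add: scalar_prod_def atLeast0LessThan)

lemma symmetric_matD:
  assumes "transpose_mat A = A" "i < dim_row A" "j < dim_row A"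
  shows "A $$ (i, j) = A $$ (j, i)"
proof -
  have "dim_col A = dim_row A" using assms(1) by (metis index_transpose_mat(2))
  then have "transpose_mat A $$ (i, j) = A $$ (j, i)" using assms(2,3) by simp
  then show ?thesis using assms(1) by simp
qed

definition mat_trace :: "real mat \<Rightarrow> real" where
  "mat_trace A = (\<Sum>i<dim_row A. A $$ (i, i))"

lemma mat_trace_comm:
  assumes "A \<in> carrier_mat p q" "B \<in> carrier_mat q p"
  shows "mat_trace (A * B) = mat_trace (B * A)"
proof -
  have "mat_trace (A * B) = (\<Sum>i<p. \<Sum>t<q. A $$ (i, t) * B $$ (t, i))"
    using assms unfolding mat_trace_def
    by (auto intro!: sum.cong simp: index_mult_mat_sum[OF assms] simp del: index_mult_mat(1))
  also have "\<dots> = (\<Sum>t<q. \<Sum>i<p. B $$ (t, i) * A $$ (i, t))"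
    by (subst sum.swap) (simp add: mult.commute)
  also have "\<dots> = mat_trace (B * A)"
    using assms unfolding mat_trace_def
    by (auto intro!: sum.cong simp: index_mult_mat_sum[OF assms(2,1)] simp del: index_mult_mat(1))
  finally show ?thesis .
qed

lemma mat_trace_add:
  assumes "A \<in> carrier_mat p p" "B \<in> carrier_mat p p"
  shows "mat_trace (A + B) = mat_trace A + mat_trace B"
  using assms by (simp add: mat_trace_def sum.distrib)

lemma mat_trace_minus:
  assumes "A \<in> carrier_mat p p" "B \<in> carrier_mat p p"
  shows "mat_trace (A - B) = mat_trace A - mat_trace B"
  using assms by (simp add: mat_trace_def sum_subtractf)

lemma frobenius_norm_eq_trace:
  assumes A: "A \<in> carrier_mat N N" and sym: "transpose_mat A = A"
  shows "(frobenius_norm A)\<^sup>2 = mat_trace (A * A)"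
proof -
  have "(frobenius_norm A)\<^sup>2 = (\<Sum>i<N. \<Sum>k<N. (A $$ (i, k))\<^sup>2)"
    using A by (simp add: frobenius_norm_def sum_nonneg)
  also have "\<dots> = (\<Sum>i<N. \<Sum>k<N. A $$ (i, k) * A $$ (k, i))"
    using symmetric_matD[OF sym] A by (intro sum.cong) (auto simp: power2_eq_square)
  also have "\<dots> = mat_trace (A * A)"
    using A unfolding mat_trace_def
    by (auto intro!: sum.cong simp: index_mult_mat_sum[OF A A] simp del: index_mult_mat(1))
  finally show ?thesis .
qed

section \<open>Positive square roots\<close>

lemma mat_trace_conj_eq_quadratic_forms:
  assumes D: "D \<in> carrier_mat N N" "transpose_mat D = D" and B: "B \<in> carrier_mat N N"
  shows "mat_trace (D * (B * D)) = (\<Sum>i<N. col D i \<bullet> (B *\<^sub>v col D i))"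
proof -
  have "(D * (B * D)) $$ (i, i) = col D i \<bullet> (B *\<^sub>v col D i)" if "i < N" for i
  proof -
    have "row D i = col D i" using D that by (metis carrier_matD(1) col_transpose)
    moreover have "col (B * D) i = B *\<^sub>v col D i" using B D that by (simp add: col_mult2)
    ultimately show ?thesis using B D that by simp
  qed
  then show ?thesis using B D by (simp add: mat_trace_def)
qed

text \<open>
  For D = B - C the identity B B = C C says B D + D C = 0. Multiplying by D and taking traces gives
  tr (D B D) + tr (D C D) = 0, where both traces are sums of quadratic forms over the columns of D and
  so nonnegative. As B is definite, every column of D vanishes. This avoids diagonalising B or C.
\<close>

lemma pos_semidef_sqrt_unique:
  assumes B: "B \<in> carrier_mat N N" "transpose_mat B = B"
    and pos: "\<And>x. x \<in> carrier_vec N \<Longrightarrow> x \<noteq> 0\<^sub>v N \<Longrightarrow> 0 < x \<bullet> (B *\<^sub>v x)"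
    and C: "pos_semidef N C" and eq: "B * B = C * C"
  shows "C = B"
proof -
  have C': "C \<in> carrier_mat N N" "transpose_mat C = C"
    and psd: "\<And>x. x \<in> carrier_vec N \<Longrightarrow> 0 \<le> x \<bullet> (C *\<^sub>v x)"
    using C by (auto simp: pos_semidef_def)
  define D where "D = B - C"
  have D: "D \<in> carrier_mat N N" and D': "transpose_mat D = D"
    using B C' by (auto simp: D_def transpose_minus)
  have [simp]: "col D i \<in> carrier_vec N" if "i < N" for i using D that by auto
  have "B * D + D * C = 0\<^sub>m N N"
  proof -
    have "B * D + D * C = (B * B - B * C) + (B * C - C * C)"
      using B C' by (simp add: D_def mult_minus_distrib_mat minus_mult_distrib_mat)
    also have "\<dots> = 0\<^sub>m N N" unfolding eq
      using B C' by (intro eq_matI) auto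
    finally show ?thesis .
  qed
  then have "0\<^sub>m N N = D * (B * D + D * C)" using D by simp
  also have "\<dots> = D * (B * D) + D * (D * C)"
    using B C' D by (intro mult_add_distrib_mat[of _ N N _ N]) auto
  finally have "mat_trace (D * (B * D) + D * (D * C)) = mat_trace (0\<^sub>m N N)" by simp
  also have "\<dots> = 0" by (simp add: mat_trace_def)
  finally have "mat_trace (D * (B * D) + D * (D * C)) = 0" .
  then have "mat_trace (D * (B * D)) + mat_trace (D * (D * C)) = 0"
    using B C' D by (subst (asm) mat_trace_add[of _ N]) auto
  moreover have "mat_trace (D * (D * C)) = mat_trace (D * (C * D))"
  proof -
    have "mat_trace (D * (D * C)) = mat_trace ((D * C) * D)"
      using C' D by (intro mat_trace_comm[of _ N N]) auto
    also have "(D * C) * D = D * (C * D)" using C' D by (intro assoc_mult_mat) auto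
    finally show ?thesis .
  qed
  ultimately have 0: "(\<Sum>i<N. col D i \<bullet> (B *\<^sub>v col D i)) + (\<Sum>i<N. col D i \<bullet> (C *\<^sub>v col D i)) = 0"
    using mat_trace_conj_eq_quadratic_forms[OF D D' B(1)]
      mat_trace_conj_eq_quadratic_forms[OF D D' C'(1)] by simp
  have nonneg: "0 \<le> col D i \<bullet> (B *\<^sub>v col D i)" if "i < N" for i
  proof (cases "col D i = 0\<^sub>v N")
    case True then show ?thesis using B by simp
  next
    case False then show ?thesis using pos that by (simp add: less_imp_le)
  qed
  have "(\<Sum>i<N. col D i \<bullet> (B *\<^sub>v col D i)) = 0"
    using 0 nonneg psd by (smt (verit) lessThan_iff sum_nonneg \<open>\<And>i. i < N \<Longrightarrow> col D i \<in> carrier_vec N\<close>)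
  then have "col D i \<bullet> (B *\<^sub>v col D i) = 0" if "i < N" for i
    using nonneg that by (subst (asm) sum_nonneg_eq_0_iff) auto
  then have "col D i = 0\<^sub>v N" if "i < N" for i using pos[of "col D i"] that by force
  then have "D $$ (i, j) = 0" if "i < N" "j < N" for i j
    using that D by (metis carrier_matD(1,2) index_col index_zero_vec(1))
  then show ?thesis
    using B C' by (intro eq_matI) (auto simp: D_def)
qed

lemma inv_sqrt_mat_eqI:
  assumes B: "B \<in> carrier_mat N N" "transpose_mat B = B"
    and pos: "\<And>x. x \<in> carrier_vec N \<Longrightarrow> x \<noteq> 0\<^sub>v N \<Longrightarrow> 0 < x \<bullet> (B *\<^sub>v x)"
    and A: "A = B * B" and C: "C \<in> carrier_mat N N" "B * C = 1\<^sub>m N" "C * B = 1\<^sub>m N"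
  shows "inv_sqrt_mat A = C"
proof -
  have psd: "pos_semidef N B"
    unfolding pos_semidef_def
  proof (intro conjI ballI B)
    fix x :: "real vec" assume x: "x \<in> carrier_vec N"
    show "0 \<le> x \<bullet> (B *\<^sub>v x)"
      using pos[OF x] B x by (cases "x = 0\<^sub>v N") (auto simp: less_imp_le)
  qed
  have "dim_row A = N" using A B by simp
  then have sqrt: "sqrt_mat A = B"
    unfolding sqrt_mat_def
    using psd pos_semidef_sqrt_unique[OF B pos] A by (intro the_equality) auto
  have "B \<in> Units (ring_mat TYPE(real) N undefined)"
    using B C by (auto simp: Units_def ring_mat_def)
  then obtain C' where C': "mat_inverse B = Some C'"
    using mat_inverse(1)[OF B(1), where b = undefined] by (cases "mat_inverse B") auto
  note inv = mat_inverse(2)[OF B(1) C']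
  have "C' = C' * (B * C)" using inv C(2) right_mult_one_mat[of C' N N] by simp
  also have "\<dots> = (C' * B) * C" using inv C B by (intro assoc_mult_mat[symmetric]) auto
  also have "\<dots> = C" using inv C by simp
  finally show ?thesis unfolding inv_sqrt_mat_def sqrt C' by simp
qed

section \<open>Combinations of orthogonal projections\<close>

text \<open>
  Given by entries, so that sums of matrices of a fixed size over an arbitrary index set reduce to sums
  of reals.
\<close>

definition mat_comb :: "nat \<Rightarrow> 'k set \<Rightarrow> ('k \<Rightarrow> real mat) \<Rightarrow> ('k \<Rightarrow> real) \<Rightarrow> real mat" where
  "mat_comb N K E f = mat N N (\<lambda>(i, j). \<Sum>k\<in>K. f k * E k $$ (i, j))"

lemma mat_comb_carrier [simp]: "mat_comb N K E f \<in> carrier_mat N N"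
  by (simp add: mat_comb_def)

lemma index_mat_comb [simp]:
  "i < N \<Longrightarrow> j < N \<Longrightarrow> mat_comb N K E f $$ (i, j) = (\<Sum>k\<in>K. f k * E k $$ (i, j))"
  "dim_row (mat_comb N K E f) = N" "dim_col (mat_comb N K E f) = N"
  by (simp_all add: mat_comb_def)

lemma mat_comb_conj:
  assumes A: "A \<in> carrier_mat p N" and B: "B \<in> carrier_mat N p"
    and E: "\<And>k. k \<in> K \<Longrightarrow> E k \<in> carrier_mat N N"
  shows "A * mat_comb N K E f * B = mat_comb p K (\<lambda>k. A * E k * B) f"
proof (rule eq_matI)
  fix i j assume "i < dim_row (mat_comb p K (\<lambda>k. A * E k * B) f)"
    "j < dim_col (mat_comb p K (\<lambda>k. A * E k * B) f)"
  then have ij: "i < p" "j < p" by auto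
  have entry: "(A * X * B) $$ (i, j) = (\<Sum>t<N. \<Sum>s<N. A $$ (i, s) * X $$ (s, t) * B $$ (t, j))"
    if X: "X \<in> carrier_mat N N" for X
  proof -
    have "A * X \<in> carrier_mat p N" using A X by auto
    then show ?thesis
      using ij by (simp add: index_mult_mat_sum[OF _ B] index_mult_mat_sum[OF A X] sum_distrib_right)
  qed
  have "(A * mat_comb N K E f * B) $$ (i, j)
      = (\<Sum>t<N. \<Sum>s<N. A $$ (i, s) * (\<Sum>k\<in>K. f k * E k $$ (s, t)) * B $$ (t, j))"
    by (simp add: entry)
  also have "\<dots> = (\<Sum>t<N. \<Sum>s<N. \<Sum>k\<in>K. f k * (A $$ (i, s) * E k $$ (s, t) * B $$ (t, j)))"
    by (simp add: sum_distrib_left sum_distrib_right mult_ac)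
  also have "\<dots> = (\<Sum>t<N. \<Sum>k\<in>K. \<Sum>s<N. f k * (A $$ (i, s) * E k $$ (s, t) * B $$ (t, j)))"
    by (intro sum.cong refl sum.swap)
  also have "\<dots> = (\<Sum>k\<in>K. \<Sum>t<N. \<Sum>s<N. f k * (A $$ (i, s) * E k $$ (s, t) * B $$ (t, j)))"
    by (rule sum.swap)
  also have "\<dots> = (\<Sum>k\<in>K. f k * (A * E k * B) $$ (i, j))"
    using E by (intro sum.cong) (auto simp: entry sum_distrib_left)
  finally show "(A * mat_comb N K E f * B) $$ (i, j) = mat_comb p K (\<lambda>k. A * E k * B) f $$ (i, j)"
    using ij by simp
qed (use A B in auto)

lemma mat_trace_mat_comb:
  assumes "\<And>k. k \<in> K \<Longrightarrow> E k \<in> carrier_mat N N"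
  shows "mat_trace (mat_comb N K E f) = (\<Sum>k\<in>K. f k * mat_trace (E k))"
proof -
  have "mat_trace (mat_comb N K E f) = (\<Sum>i<N. \<Sum>k\<in>K. f k * E k $$ (i, i))"
    by (simp add: mat_trace_def)
  also have "\<dots> = (\<Sum>k\<in>K. \<Sum>i<N. f k * E k $$ (i, i))" by (rule sum.swap)
  also have "\<dots> = (\<Sum>k\<in>K. f k * mat_trace (E k))"
    using assms by (intro sum.cong) (auto simp: mat_trace_def sum_distrib_left)
  finally show ?thesis .
qed

lemma quadratic_form_mat_comb:
  assumes "\<And>k. k \<in> K \<Longrightarrow> E k \<in> carrier_mat N N" and x: "x \<in> carrier_vec N"
  shows "x \<bullet> (mat_comb N K E f *\<^sub>v x) = (\<Sum>k\<in>K. f k * (x \<bullet> (E k *\<^sub>v x)))"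
proof -
  have qf: "x \<bullet> (X *\<^sub>v x) = (\<Sum>i<N. \<Sum>j<N. x $ i * X $$ (i, j) * x $ j)"
    if "X \<in> carrier_mat N N" for X
    using that x by (auto simp: scalar_prod_def atLeast0LessThan sum_distrib_left mult_ac
        intro!: sum.cong)
  have "x \<bullet> (mat_comb N K E f *\<^sub>v x)
      = (\<Sum>i<N. \<Sum>j<N. \<Sum>k\<in>K. f k * (x $ i * E k $$ (i, j) * x $ j))"
    by (simp add: qf sum_distrib_left sum_distrib_right mult_ac)
  also have "\<dots> = (\<Sum>i<N. \<Sum>k\<in>K. \<Sum>j<N. f k * (x $ i * E k $$ (i, j) * x $ j))"
    by (intro sum.cong refl sum.swap)
  also have "\<dots> = (\<Sum>k\<in>K. \<Sum>i<N. \<Sum>j<N. f k * (x $ i * E k $$ (i, j) * x $ j))"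
    by (rule sum.swap)
  also have "\<dots> = (\<Sum>k\<in>K. f k * (x \<bullet> (E k *\<^sub>v x)))"
    using assms(1) by (intro sum.cong) (auto simp: qf sum_distrib_left)
  finally show ?thesis .
qed

text \<open>
  Coefficientwise calculus needs no eigenvectors: symmetry and these product relations suffice to
  multiply combinations, and completeness (in the extension below) makes them a spectral resolution.
  Members of the family may be zero.
\<close>

locale orthogonal_projections =
  fixes N :: nat and K :: "'k set" and E :: "'k \<Rightarrow> real mat"
  assumes finite: "finite K"
    and carrier [simp]: "k \<in> K \<Longrightarrow> E k \<in> carrier_mat N N"
    and symmetric: "k \<in> K \<Longrightarrow> transpose_mat (E k) = E k"
    and prod: "k \<in> K \<Longrightarrow> l \<in> K \<Longrightarrow> E k * E l = (if k = l then E k else 0\<^sub>m N N)"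
begin

lemma dims [simp]:
  assumes "k \<in> K" shows "dim_row (E k) = N" "dim_col (E k) = N"
  using carrier[OF assms] by auto

abbreviation comb :: "('k \<Rightarrow> real) \<Rightarrow> real mat" where
  "comb \<equiv> mat_comb N K E"

lemma comb_symmetric: "transpose_mat (comb f) = comb f"
proof (rule eq_matI)
  fix i j assume "i < dim_row (comb f)" "j < dim_col (comb f)"
  then have ij: "i < N" "j < N" by auto
  have "E k $$ (j, i) = E k $$ (i, j)" if "k \<in> K" for k
    using symmetric_matD[OF symmetric[OF that]] carrier[OF that] ij by simp
  then show "transpose_mat (comb f) $$ (i, j) = comb f $$ (i, j)"
    using ij by simp
qed auto

lemma mult_comb:
  assumes "k \<in> K"
  shows "E k * comb g = g k \<cdot>\<^sub>m E k" and "comb g * E k = g k \<cdot>\<^sub>m E k"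
proof -
  have *: "mat_comb N K F g = g k \<cdot>\<^sub>m E k"
    if F: "\<And>l. l \<in> K \<Longrightarrow> F l = (if k = l then E k else 0\<^sub>m N N)" for F
  proof (rule eq_matI)
    fix i j assume "i < dim_row (g k \<cdot>\<^sub>m E k)" "j < dim_col (g k \<cdot>\<^sub>m E k)"
    then have ij: "i < N" "j < N" using carrier[OF assms] by auto
    have "(\<Sum>l\<in>K. g l * F l $$ (i, j)) = (\<Sum>l\<in>K. if k = l then g k * E k $$ (i, j) else 0)"
      using F ij by (intro sum.cong) auto
    then show "mat_comb N K F g $$ (i, j) = (g k \<cdot>\<^sub>m E k) $$ (i, j)"
      using ij assms finite by simp
  qed (use carrier[OF assms] in auto)
  have "E k * comb g * 1\<^sub>m N = mat_comb N K (\<lambda>l. E k * E l * 1\<^sub>m N) g"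
    using assms by (intro mat_comb_conj) auto
  also have "\<dots> = g k \<cdot>\<^sub>m E k" using assms by (intro *) (simp add: prod)
  finally show "E k * comb g = g k \<cdot>\<^sub>m E k"
    using carrier[OF assms] by simp
  have "1\<^sub>m N * comb g * E k = mat_comb N K (\<lambda>l. 1\<^sub>m N * E l * E k) g"
    using assms by (intro mat_comb_conj) auto
  also have "\<dots> = g k \<cdot>\<^sub>m E k" using assms by (intro *) (auto simp: prod)
  finally show "comb g * E k = g k \<cdot>\<^sub>m E k"
    by simp
qed

lemma comb_mult: "comb f * comb g = comb (\<lambda>k. f k * g k)"
proof -
  have "comb f * comb g = 1\<^sub>m N * comb f * comb g" by simp
  also have "\<dots> = mat_comb N K (\<lambda>k. 1\<^sub>m N * E k * comb g) f"
    by (intro mat_comb_conj) auto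
  also have "\<dots> = comb (\<lambda>k. f k * g k)"
  proof (rule eq_matI)
    fix i j assume "i < dim_row (comb (\<lambda>k. f k * g k))" "j < dim_col (comb (\<lambda>k. f k * g k))"
    then have ij: "i < N" "j < N" by auto
    have "1\<^sub>m N * E k * comb g = g k \<cdot>\<^sub>m E k" if "k \<in> K" for k
      using left_mult_one_mat[OF carrier[OF that]] that by (simp add: mult_comb)
    then show "mat_comb N K (\<lambda>k. 1\<^sub>m N * E k * comb g) f $$ (i, j) = comb (\<lambda>k. f k * g k) $$ (i, j)"
      using ij by (auto intro!: sum.cong simp del: index_mult_mat(1))
  qed auto
  finally show ?thesis .
qed

lemma quadratic_form_nonneg:
  assumes k: "k \<in> K" and x: "x \<in> carrier_vec N"
  shows "0 \<le> x \<bullet> (E k *\<^sub>v x)"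
proof -
  have "x \<bullet> (E k *\<^sub>v x) = x \<bullet> (E k *\<^sub>v (E k *\<^sub>v x))"
    using prod[OF k k] carrier[OF k] x by (metis assoc_mult_mat_vec)
  also have "\<dots> = (E k *\<^sub>v x) \<bullet> (E k *\<^sub>v x)"
    using transpose_vec_mult_scalar[OF carrier[OF k] _ x, of "E k *\<^sub>v x"] symmetric[OF k]
      carrier[OF k] x by simp
  also have "\<dots> \<ge> 0" by (simp add: scalar_prod_def sum_nonneg)
  finally show ?thesis .
qed

lemma frobenius_norm_comb: "(frobenius_norm (comb f))\<^sup>2 = (\<Sum>k\<in>K. (f k)\<^sup>2 * mat_trace (E k))"
  unfolding frobenius_norm_eq_trace[OF mat_comb_carrier comb_symmetric] comb_mult
  by (simp add: mat_trace_mat_comb power2_eq_square)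

end

locale complete_orthogonal_projections = orthogonal_projections +
  assumes complete: "mat_comb N K E (\<lambda>_. 1) = 1\<^sub>m N"
begin

lemma norm_decomposition:
  assumes "x \<in> carrier_vec N"
  shows "(\<Sum>k\<in>K. x \<bullet> (E k *\<^sub>v x)) = x \<bullet> x"
  using quadratic_form_mat_comb[of K E N x "\<lambda>_. 1"] assms complete by simp

lemma comb_pos_def:
  assumes pos: "\<And>k. k \<in> K \<Longrightarrow> 0 < f k" and x: "x \<in> carrier_vec N" "x \<noteq> 0\<^sub>v N"
  shows "0 < x \<bullet> (comb f *\<^sub>v x)"
proof (rule ccontr)
  assume "\<not> ?thesis"
  then have "(\<Sum>k\<in>K. f k * (x \<bullet> (E k *\<^sub>v x))) \<le> 0"
    by (simp add: quadratic_form_mat_comb x)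
  moreover have nn: "0 \<le> f k * (x \<bullet> (E k *\<^sub>v x))" if "k \<in> K" for k
    using pos[OF that] quadratic_form_nonneg[OF that x(1)] by simp
  ultimately have "(\<Sum>k\<in>K. f k * (x \<bullet> (E k *\<^sub>v x))) = 0"
    by (meson order_antisym sum_nonneg)
  then have "f k * (x \<bullet> (E k *\<^sub>v x)) = 0" if "k \<in> K" for k
    using that nn finite by (subst (asm) sum_nonneg_eq_0_iff) auto
  then have "x \<bullet> (E k *\<^sub>v x) = 0" if "k \<in> K" for k using pos that by force
  then have "x \<bullet> x = 0" using norm_decomposition[OF x(1)] by simp
  then have "(\<Sum>i<N. x $ i * x $ i) = 0" using x by (simp add: scalar_prod_def atLeast0LessThan)
  then have "\<forall>i<N. x $ i = 0" by (subst (asm) sum_nonneg_eq_0_iff) auto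
  then have "x = 0\<^sub>v N" using x by (intro eq_vecI) auto
  then show False using x by simp
qed

text \<open>
  The combination with coefficients sqrt (f k) is a positive definite root, hence the root that the
  definition of the square root selects.
\<close>

lemma inv_sqrt_mat_comb:
  assumes pos: "\<And>k. k \<in> K \<Longrightarrow> 0 < f k"
  shows "inv_sqrt_mat (comb f) = comb (\<lambda>k. 1 / sqrt (f k))"
proof -
  have cong: "comb g = comb h" if "\<And>k. k \<in> K \<Longrightarrow> g k = h k" for g h
    using that by (intro eq_matI) auto
  show ?thesis
  proof (rule inv_sqrt_mat_eqI[where N = N and B = "comb (\<lambda>k. sqrt (f k))"])
    show "0 < x \<bullet> (comb (\<lambda>k. sqrt (f k)) *\<^sub>v x)" if "x \<in> carrier_vec N" "x \<noteq> 0\<^sub>v N" for x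
      using that pos by (intro comb_pos_def) auto
    show "comb f = comb (\<lambda>k. sqrt (f k)) * comb (\<lambda>k. sqrt (f k))"
      unfolding comb_mult using pos by (intro cong) (simp add: less_imp_le)
    show "comb (\<lambda>k. sqrt (f k)) * comb (\<lambda>k. 1 / sqrt (f k)) = 1\<^sub>m N"
      unfolding comb_mult complete[symmetric] using pos by (intro cong) (simp add: less_imp_le less_imp_neq[symmetric])
    show "comb (\<lambda>k. 1 / sqrt (f k)) * comb (\<lambda>k. sqrt (f k)) = 1\<^sub>m N"
      unfolding comb_mult complete[symmetric] using pos by (intro cong) (simp add: less_imp_le less_imp_neq[symmetric])
  qed (auto simp: comb_symmetric)
qed

lemma standardized_comb:
  assumes pos: "\<And>k. k \<in> K \<Longrightarrow> 0 < g k"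
  shows "inv_sqrt_mat (comb g) * comb f * inv_sqrt_mat (comb g) = comb (\<lambda>k. f k / g k)"
proof -
  have *: "1 / sqrt (g k) * f k * (1 / sqrt (g k)) = f k / g k" if "k \<in> K" for k
  proof -
    have "1 / s * t * (1 / s) = t / (s * s)" for s t :: real by simp
    moreover have "sqrt (g k) * sqrt (g k) = g k" using pos[OF that] by simp
    ultimately show ?thesis by (simp only:)
  qed
  have "inv_sqrt_mat (comb g) = comb (\<lambda>k. 1 / sqrt (g k))"
    using pos by (rule inv_sqrt_mat_comb)
  then have "inv_sqrt_mat (comb g) * comb f * inv_sqrt_mat (comb g)
      = comb (\<lambda>k. 1 / sqrt (g k) * f k * (1 / sqrt (g k)))"
    by (simp only: comb_mult)
  also have "\<dots> = comb (\<lambda>k. f k / g k)"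
    by (simp only: mat_comb_def * cong: sum.cong)
  finally show ?thesis .
qed

lemma vec_norm_comb_le:
  assumes bound: "\<And>k. k \<in> K \<Longrightarrow> (f k)\<^sup>2 \<le> c" and c: "0 \<le> c"
    and x: "x \<in> carrier_vec N" and le: "vec_norm x \<le> 1"
  shows "vec_norm (comb f *\<^sub>v x) \<le> sqrt c"
proof -
  have cx: "comb f *\<^sub>v x \<in> carrier_vec N" by (intro mult_mat_vec_carrier[OF mat_comb_carrier x])
  have "(comb f *\<^sub>v x) \<bullet> (comb f *\<^sub>v x) = x \<bullet> (comb f *\<^sub>v (comb f *\<^sub>v x))"
    using transpose_vec_mult_scalar[OF mat_comb_carrier cx x, of K E f] comb_symmetric[of f]
      comm_scalar_prod[OF x, of "comb f *\<^sub>v (comb f *\<^sub>v x)"] mult_mat_vec_carrier[OF mat_comb_carrier cx]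
    by simp
  also have "comb f *\<^sub>v (comb f *\<^sub>v x) = comb (\<lambda>k. (f k)\<^sup>2) *\<^sub>v x"
    using assoc_mult_mat_vec[OF mat_comb_carrier mat_comb_carrier x, of K E f K E f]
    by (simp add: comb_mult power2_eq_square)
  also have "x \<bullet> (comb (\<lambda>k. (f k)\<^sup>2) *\<^sub>v x) = (\<Sum>k\<in>K. (f k)\<^sup>2 * (x \<bullet> (E k *\<^sub>v x)))"
    by (simp add: quadratic_form_mat_comb x)
  also have "\<dots> \<le> (\<Sum>k\<in>K. c * (x \<bullet> (E k *\<^sub>v x)))"
    using bound quadratic_form_nonneg x by (intro sum_mono mult_right_mono) auto
  also have "\<dots> = c * (x \<bullet> x)"
    by (simp add: sum_distrib_left[symmetric] norm_decomposition x)
  also have "\<dots> \<le> c"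
    using le c by (simp add: vec_norm_def mult_left_le)
  finally show ?thesis by (simp add: vec_norm_def)
qed

text \<open>
  The lower bound lets the upper one be squared. As a supremum of reals, the norm is nonnegative only
  because the set is bounded and contains 0.
\<close>

lemma spectral_norm_comb_bounds:
  assumes bound: "\<And>k. k \<in> K \<Longrightarrow> (f k)\<^sup>2 \<le> c" and c: "0 \<le> c"
  shows "0 \<le> spectral_norm (comb f)" and "spectral_norm (comb f) \<le> sqrt c"
proof -
  let ?X = "{vec_norm (comb f *\<^sub>v x) |x. x \<in> carrier_vec (dim_col (comb f)) \<and> vec_norm x \<le> 1}"
  have ub: "y \<le> sqrt c" if "y \<in> ?X" for y
    using that vec_norm_comb_le[OF bound c] by auto
  have zero: "0 \<in> ?X"
  proof -
    have "comb f *\<^sub>v 0\<^sub>v N = 0\<^sub>v N" by (intro eq_vecI) auto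
    then show ?thesis by (auto simp: vec_norm_def intro!: exI[of _ "0\<^sub>v N"])
  qed
  show "0 \<le> spectral_norm (comb f)" unfolding spectral_norm_def
    using ub by (intro cSup_upper zero bdd_aboveI)
  show "spectral_norm (comb f) \<le> sqrt c" unfolding spectral_norm_def
    using ub zero by (intro cSup_least) auto
qed

text \<open>
  The sum over l is the squared Frobenius norm, and the spectral norm is bounded by the largest
  coefficient in modulus. Only this upper bound enters, which is why zero members of the family do
  no harm.
\<close>

lemma norm_ratio_comb_le:
  assumes bound: "\<And>k. k \<in> K \<Longrightarrow> (f k)\<^sup>2 \<le> c * (\<Sum>l\<in>K. (f l)\<^sup>2 * mat_trace (E l))"
    and c: "0 \<le> c" and pos: "0 < (\<Sum>l\<in>K. (f l)\<^sup>2 * mat_trace (E l))"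
  shows "(norm_ratio (comb f))\<^sup>2 \<le> c"
proof -
  let ?F = "frobenius_norm (comb f)"
  have F: "?F\<^sup>2 = (\<Sum>l\<in>K. (f l)\<^sup>2 * mat_trace (E l))" by (rule frobenius_norm_comb)
  have F0: "0 < ?F"
  proof -
    have "0 \<le> ?F" by (simp add: frobenius_norm_def sum_nonneg)
    moreover have "?F \<noteq> 0" using pos F by auto
    ultimately show ?thesis by simp
  qed
  have nn: "0 \<le> c * ?F\<^sup>2" using c by simp
  have b: "(f k)\<^sup>2 \<le> c * ?F\<^sup>2" if "k \<in> K" for k
    using bound[OF that] unfolding F .
  have "(spectral_norm (comb f))\<^sup>2 \<le> (sqrt (c * ?F\<^sup>2))\<^sup>2"
    using spectral_norm_comb_bounds[of f, OF b nn] by (intro power_mono)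
  also have "\<dots> = c * ?F\<^sup>2" using nn by simp
  finally have "(spectral_norm (comb f))\<^sup>2 \<le> c * ?F\<^sup>2" .
  then show ?thesis
    using F0 by (simp add: norm_ratio_def power_divide divide_le_eq)
qed

end

section \<open>Kronecker products\<close>

text \<open>
  Row and column indices of a Kronecker product are pairs coded by division with remainder; this
  decodes a sum over such indices.
\<close>

lemma sum_div_mod:
  fixes F :: "nat \<Rightarrow> nat \<Rightarrow> real"
  shows "(\<Sum>t<a * b. F (t div b) (t mod b)) = (\<Sum>s<a. \<Sum>u<b. F s u)"
proof -
  have "(\<Sum>s<a. \<Sum>u<b. F s u) = (\<Sum>(s, u)\<in>{..<a} \<times> {..<b}. F s u)"
    by (rule sum.cartesian_product)
  also have "\<dots> = (\<Sum>t<a * b. F (t div b) (t mod b))"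
  proof (rule sum.reindex_bij_witness[where j = "\<lambda>(s, u). s * b + u" and i = "\<lambda>t. (t div b, t mod b)"])
    fix x assume "x \<in> {..<a} \<times> {..<b}"
    then obtain s u where x: "x = (s, u)" "s < a" "u < b" by auto
    have "s * b + u < Suc s * b" using x by simp
    also have "\<dots> \<le> a * b" using x by (intro mult_le_mono1) simp
    finally show "(case x of (s, u) \<Rightarrow> s * b + u) \<in> {..<a * b}" using x by simp
  next
    fix t assume "t \<in> {..<a * b}"
    then have t: "t < a * b" by simp
    then have "0 < b" by (cases b) auto
    then show "(t div b, t mod b) \<in> {..<a} \<times> {..<b}"
      using t by (simp add: less_mult_imp_div_less)
  qed auto
  finally show ?thesis ..
qed

lemma kronecker_carrier:
  assumes "A \<in> carrier_mat a a" "B \<in> carrier_mat b b"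
  shows "kronecker A B \<in> carrier_mat (a * b) (a * b)"
  using assms by (simp add: kronecker_def)

lemma index_kronecker:
  assumes "A \<in> carrier_mat a a" "B \<in> carrier_mat b b" "i < a * b" "j < a * b"
  shows "kronecker A B $$ (i, j) = A $$ (i div b, j div b) * B $$ (i mod b, j mod b)"
  using assms by (simp add: kronecker_def)

lemma div_mod_less:
  fixes i :: nat
  assumes "i < a * b"
  shows "i div b < a" "i mod b < b"
proof -
  have "0 < b" using assms by (cases b) auto
  then show "i div b < a" "i mod b < b" using assms by (auto simp: less_mult_imp_div_less)
qed

lemma kronecker_mult:
  assumes A: "A \<in> carrier_mat a a" and B: "B \<in> carrier_mat b b"
    and C: "C \<in> carrier_mat a a" and D: "D \<in> carrier_mat b b"
  shows "kronecker A B * kronecker C D = kronecker (A * C) (B * D)"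
proof (rule eq_matI)
  note AB = kronecker_carrier[OF A B] and CD = kronecker_carrier[OF C D]
  have AC: "A * C \<in> carrier_mat a a" and BD: "B * D \<in> carrier_mat b b" using A B C D by auto
  fix i j assume "i < dim_row (kronecker (A * C) (B * D))" "j < dim_col (kronecker (A * C) (B * D))"
  then have ij: "i < a * b" "j < a * b" using kronecker_carrier[OF AC BD] by auto
  note dm = div_mod_less[OF ij(1)] div_mod_less[OF ij(2)]
  have "(kronecker A B * kronecker C D) $$ (i, j)
      = (\<Sum>t<a * b. kronecker A B $$ (i, t) * kronecker C D $$ (t, j))"
    by (rule index_mult_mat_sum[OF AB CD ij])
  also have "\<dots> = (\<Sum>t<a * b. (A $$ (i div b, t div b) * B $$ (i mod b, t mod b)) *
        (C $$ (t div b, j div b) * D $$ (t mod b, j mod b)))"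
    using ij by (intro sum.cong) (auto simp: index_kronecker[OF A B] index_kronecker[OF C D])
  also have "\<dots> = (\<Sum>s<a. \<Sum>u<b. (A $$ (i div b, s) * B $$ (i mod b, u)) *
        (C $$ (s, j div b) * D $$ (u, j mod b)))"
    by (rule sum_div_mod)
  also have "\<dots> = (\<Sum>s<a. A $$ (i div b, s) * C $$ (s, j div b)) *
      (\<Sum>u<b. B $$ (i mod b, u) * D $$ (u, j mod b))"
    by (simp add: sum_product mult_ac)
  also have "\<dots> = kronecker (A * C) (B * D) $$ (i, j)"
    unfolding index_kronecker[OF AC BD ij]
    by (simp only: index_mult_mat_sum[OF A C dm(1,3)] index_mult_mat_sum[OF B D dm(2,4)])
  finally show "(kronecker A B * kronecker C D) $$ (i, j) = kronecker (A * C) (B * D) $$ (i, j)" .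
qed (use assms in \<open>auto simp: kronecker_def\<close>)

lemma kronecker_transpose:
  assumes A: "A \<in> carrier_mat a a" and B: "B \<in> carrier_mat b b"
  shows "transpose_mat (kronecker A B) = kronecker (transpose_mat A) (transpose_mat B)"
  using assms by (intro eq_matI) (auto simp: kronecker_def div_mod_less)

lemma mat_trace_kronecker:
  assumes A: "A \<in> carrier_mat a a" and B: "B \<in> carrier_mat b b"
  shows "mat_trace (kronecker A B) = mat_trace A * mat_trace B"
proof -
  have "mat_trace (kronecker A B) = (\<Sum>t<a * b. A $$ (t div b, t div b) * B $$ (t mod b, t mod b))"
    using kronecker_carrier[OF A B] by (simp add: mat_trace_def index_kronecker[OF A B])
  also have "\<dots> = (\<Sum>s<a. \<Sum>u<b. A $$ (s, s) * B $$ (u, u))"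
    by (rule sum_div_mod)
  finally show ?thesis using A B by (simp add: mat_trace_def sum_product)
qed

lemma kronecker_mean_mat: "kronecker (mean_mat a) (mean_mat b) = mean_mat (a * b)"
  by (intro eq_matI) (auto simp: kronecker_def mean_mat_def div_mod_less)

lemma kronecker_list_simps [simp]:
  "kronecker_list [] = 1\<^sub>m 1"
  "kronecker_list (A # As) = kronecker A (kronecker_list As)"
  by (simp_all add: kronecker_list_def)

lemma kronecker_list_carrier:
  assumes "\<And>i. i \<in> set xs \<Longrightarrow> f i \<in> carrier_mat (d i) (d i)"
  shows "kronecker_list (map f xs) \<in> carrier_mat (prod_list (map d xs)) (prod_list (map d xs))"
  using assms by (induction xs) (auto intro!: kronecker_carrier)

lemma kronecker_list_mult:
  assumes "\<And>i. i \<in> set xs \<Longrightarrow> f i \<in> carrier_mat (d i) (d i)"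
    and "\<And>i. i \<in> set xs \<Longrightarrow> g i \<in> carrier_mat (d i) (d i)"
  shows "kronecker_list (map f xs) * kronecker_list (map g xs) = kronecker_list (map (\<lambda>i. f i * g i) xs)"
  using assms
proof (induction xs)
  case (Cons x xs)
  have "kronecker_list (map f xs) * kronecker_list (map g xs) = kronecker_list (map (\<lambda>i. f i * g i) xs)"
    using Cons by simp
  then show ?case
    using Cons.prems kronecker_mult[OF Cons.prems(1)[of x] kronecker_list_carrier[of xs f d]
        Cons.prems(2)[of x] kronecker_list_carrier[of xs g d]] by simp
qed simp

lemma kronecker_list_transpose:
  assumes "\<And>i. i \<in> set xs \<Longrightarrow> f i \<in> carrier_mat (d i) (d i)"
  shows "transpose_mat (kronecker_list (map f xs)) = kronecker_list (map (\<lambda>i. transpose_mat (f i)) xs)"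
  using assms
proof (induction xs)
  case (Cons x xs)
  then show ?case
    using kronecker_transpose[OF Cons.prems(1)[of x] kronecker_list_carrier[of xs f d]] by simp
qed simp

lemma mat_trace_kronecker_list:
  assumes "\<And>i. i \<in> set xs \<Longrightarrow> f i \<in> carrier_mat (d i) (d i)"
  shows "mat_trace (kronecker_list (map f xs)) = prod_list (map (\<lambda>i. mat_trace (f i)) xs)"
  using assms
proof (induction xs)
  case Nil
  show ?case by (simp add: mat_trace_def)
next
  case (Cons x xs)
  then show ?case
    using mat_trace_kronecker[OF Cons.prems(1)[of x] kronecker_list_carrier[of xs f d]] by simp
qed

lemma kronecker_list_mean_mat:
  "kronecker_list (map (\<lambda>i. mean_mat (n i)) xs) = mean_mat (prod_list (map n xs))"
proof (induction xs)
  case Nil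
  show ?case by (simp, intro eq_matI) (auto simp: mean_mat_def)
qed (simp add: kronecker_mean_mat)

lemma mean_mat_carrier [simp]: "mean_mat k \<in> carrier_mat k k"
  by (simp add: mean_mat_def)

lemma transpose_mean_mat [simp]: "transpose_mat (mean_mat k) = mean_mat k"
  by (intro eq_matI) (auto simp: mean_mat_def)

lemma mean_mat_idem [simp]: "mean_mat k * mean_mat k = mean_mat k"
  by (intro eq_matI) (auto simp: mean_mat_def scalar_prod_def power2_eq_square)

lemma one_mult_mean_mat [simp]:
  "1\<^sub>m k * mean_mat k = mean_mat k" "mean_mat k * 1\<^sub>m k = mean_mat k"
  by (rule left_mult_one_mat[OF mean_mat_carrier] right_mult_one_mat[OF mean_mat_carrier])+

lemma mat_trace_mean_mat [simp]: "0 < k \<Longrightarrow> mat_trace (mean_mat k) = 1"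
  by (simp add: mat_trace_def mean_mat_def)

lemma mat_trace_one [simp]: "mat_trace (1\<^sub>m k) = real k"
  by (simp add: mat_trace_def)

section \<open>Projections of the crossed design\<close>

lemma n_total_prod_list: "prod_list (map n [0..<r - 1]) = n_total r n"
  by (simp add: n_total_def prod.distinct_set_conv_list[symmetric] atLeast0LessThan)

lemma proj_mat_factor_carrier:
  "(if i = j then 1\<^sub>m (n i) else mean_mat (n i)) \<in> carrier_mat (n i) (n i)"
  by simp

lemma proj_mat_carrier [simp]: "proj_mat r n j \<in> carrier_mat (n_total r n) (n_total r n)"
  unfolding proj_mat_def n_total_prod_list[symmetric]
  by (intro kronecker_list_carrier proj_mat_factor_carrier)

lemma mean_mat_n_total: "mean_mat (n_total r n) = kronecker_list (map (\<lambda>i. mean_mat (n i)) [0..<r - 1])"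
  by (simp only: kronecker_list_mean_mat n_total_prod_list)

lemma transpose_proj_mat: "transpose_mat (proj_mat r n j) = proj_mat r n j"
  unfolding proj_mat_def
  by (subst kronecker_list_transpose[where d = n]) (auto intro!: arg_cong[where f = kronecker_list])

text \<open>
  In position i the factors of the two products are identities or means, and the product of the factors
  is the identity only if both are, which happens in no position when j and k differ.
\<close>

lemma proj_mat_mult:
  "proj_mat r n j * proj_mat r n k = (if j = k then proj_mat r n j else mean_mat (n_total r n))"
  unfolding mean_mat_n_total proj_mat_def
  by (subst kronecker_list_mult[where d = n])
    (auto intro!: arg_cong[where f = kronecker_list])

lemma proj_mat_mult_mean:
  "proj_mat r n j * mean_mat (n_total r n) = mean_mat (n_total r n)"
  "mean_mat (n_total r n) * proj_mat r n j = mean_mat (n_total r n)"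
proof -
  show "proj_mat r n j * mean_mat (n_total r n) = mean_mat (n_total r n)"
    unfolding mean_mat_n_total proj_mat_def
    by (subst kronecker_list_mult[where d = n]) (auto intro!: arg_cong[where f = kronecker_list])
  show "mean_mat (n_total r n) * proj_mat r n j = mean_mat (n_total r n)"
    unfolding mean_mat_n_total proj_mat_def
    by (subst kronecker_list_mult[where d = n]) (auto intro!: arg_cong[where f = kronecker_list])
qed

lemma mat_trace_proj_mat:
  assumes "\<And>i. i < r - 1 \<Longrightarrow> 0 < n i" and j: "j < r - 1"
  shows "mat_trace (proj_mat r n j) = real (n j)"
proof -
  have "mat_trace (proj_mat r n j) = prod_list (map (\<lambda>i. if i = j then real (n j) else 1) [0..<r - 1])"
    unfolding proj_mat_def
    by (subst mat_trace_kronecker_list[where d = n]) (auto intro!: arg_cong[where f = prod_list] simp: assms(1))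
  also have "\<dots> = (\<Prod>i<r - 1. if i = j then real (n j) else 1)"
    by (simp add: prod.distinct_set_conv_list[symmetric] atLeast0LessThan)
  also have "\<dots> = real (n j)" using j by (simp add: prod.delta')
  finally show ?thesis .
qed

text \<open>
  What an orthogonal family misses of the identity is again a projection, orthogonal to its members.
  The residual of the design arises in this way.
\<close>

lemma (in orthogonal_projections) complement:
  assumes k0: "k0 \<notin> K"
  shows "complete_orthogonal_projections N (insert k0 K) (E(k0 := 1\<^sub>m N - comb (\<lambda>_. 1)))"
proof -
  let ?C = "1\<^sub>m N - comb (\<lambda>_. 1)"
  let ?E = "E(k0 := ?C)"
  have self_minus: "E k - 1 \<cdot>\<^sub>m E k = 0\<^sub>m N N" if "k \<in> K" for k
    using that by (intro eq_matI) auto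
  have C: "?C \<in> carrier_mat N N" by (intro minus_carrier_mat mat_comb_carrier)
  have C': "transpose_mat ?C = ?C"
    by (simp add: transpose_minus[OF one_carrier_mat mat_comb_carrier] comb_symmetric)
  have neq: "k \<noteq> k0" if "k \<in> K" for k using that k0 by auto
  have CE: "?C * E k = 0\<^sub>m N N" "E k * ?C = 0\<^sub>m N N" if k: "k \<in> K" for k
  proof -
    have "?C * E k = 1\<^sub>m N * E k - comb (\<lambda>_. 1) * E k"
      using k by (intro minus_mult_distrib_mat) auto
    then show "?C * E k = 0\<^sub>m N N" using k by (simp add: mult_comb left_mult_one_mat[OF carrier[OF k]] self_minus)
    have "E k * ?C = E k * 1\<^sub>m N - E k * comb (\<lambda>_. 1)"
      using k by (intro mult_minus_distrib_mat) auto
    then show "E k * ?C = 0\<^sub>m N N" using k by (simp add: mult_comb right_mult_one_mat[OF carrier[OF k]] self_minus)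
  qed
  have CC: "?C * ?C = ?C"
  proof -
    have "?C * ?C = 1\<^sub>m N * ?C - comb (\<lambda>_. 1) * ?C"
      by (intro minus_mult_distrib_mat) auto
    also have "comb (\<lambda>_. 1) * ?C = comb (\<lambda>_. 1) * 1\<^sub>m N - comb (\<lambda>_. 1) * comb (\<lambda>_. 1)"
      by (intro mult_minus_distrib_mat) auto
    also have "\<dots> = 0\<^sub>m N N"
      by (simp add: comb_mult right_mult_one_mat[OF mat_comb_carrier])
    also have "1\<^sub>m N * ?C - 0\<^sub>m N N = ?C"
      unfolding left_mult_one_mat[OF C] using C by (intro eq_matI) auto
    finally show ?thesis .
  qed
  show ?thesis
  proof
    show "finite (insert k0 K)" using finite by simp
    show "?E k \<in> carrier_mat N N" if "k \<in> insert k0 K" for k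
      using that C by auto
    show "transpose_mat (?E k) = ?E k" if "k \<in> insert k0 K" for k
      using that symmetric C' by auto
    show "?E k * ?E l = (if k = l then ?E k else 0\<^sub>m N N)"
      if "k \<in> insert k0 K" "l \<in> insert k0 K" for k l
      using that CE CC prod neq by auto
    show "mat_comb N (insert k0 K) ?E (\<lambda>_. 1) = 1\<^sub>m N"
    proof (rule eq_matI)
      fix i j assume "i < dim_row (1\<^sub>m N :: real mat)" "j < dim_col (1\<^sub>m N :: real mat)"
      then have ij: "i < N" "j < N" by auto
      have "(\<Sum>k\<in>K. ?E k $$ (i, j)) = (\<Sum>k\<in>K. E k $$ (i, j))"
        using neq by (intro sum.cong) auto
      then show "mat_comb N (insert k0 K) ?E (\<lambda>_. 1) $$ (i, j) = 1\<^sub>m N $$ (i, j)"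
        using ij finite k0 by simp
    qed auto
  qed
qed

text \<open>
  The main effects carry the indices below r - 1. All other indices give the grand mean, of which the
  index r is used.
\<close>

definition effect_proj :: "nat \<Rightarrow> (nat \<Rightarrow> nat) \<Rightarrow> nat \<Rightarrow> real mat" where
  "effect_proj r n k =
     (if k < r - 1 then proj_mat r n k - mean_mat (n_total r n) else mean_mat (n_total r n))"

text \<open>
  The residual takes the index r - 1, that of the error variance.
\<close>

definition crossed_proj :: "nat \<Rightarrow> (nat \<Rightarrow> nat) \<Rightarrow> nat \<Rightarrow> real mat" where
  "crossed_proj r n = (effect_proj r n)(r - 1 := 1\<^sub>m (n_total r n) -
     mat_comb (n_total r n) (insert r {..<r - 1}) (effect_proj r n) (\<lambda>_. 1))"

text \<open>
  The eigenvalue of \<Sigma>(v) on the k-th projection of the design.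
\<close>

definition crossed_eigenvalue :: "nat \<Rightarrow> (nat \<Rightarrow> nat) \<Rightarrow> real vec \<Rightarrow> nat \<Rightarrow> real" where
  "crossed_eigenvalue r n v k =
     (if k < r - 1 then v $ k * real (n_except r n k) + v $ (r - 1)
      else if k = r - 1 then v $ (r - 1)
      else (\<Sum>j<r - 1. v $ j * real (n_except r n j)) + v $ (r - 1))"

lemma effect_proj_orthogonal:
  "orthogonal_projections (n_total r n) (insert r {..<r - 1}) (effect_proj r n)"
proof
  let ?N = "n_total r n" let ?J = "mean_mat ?N" and ?P = "proj_mat r n"
  show "effect_proj r n k \<in> carrier_mat ?N ?N" for k
    by (auto simp: effect_proj_def intro: minus_carrier_mat)
  show "transpose_mat (effect_proj r n k) = effect_proj r n k" for k
    by (auto simp: effect_proj_def transpose_minus[OF proj_mat_carrier mean_mat_carrier] transpose_proj_mat)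
  fix k l assume kl: "k \<in> insert r {..<r - 1}" "l \<in> insert r {..<r - 1}"
  have PP: "(?P k - ?J) * (?P l - ?J) = (if k = l then ?P k - ?J else 0\<^sub>m ?N ?N)"
  proof -
    have "(?P k - ?J) * (?P l - ?J) = ?P k * (?P l - ?J) - ?J * (?P l - ?J)"
      by (rule minus_mult_distrib_mat[of _ ?N ?N _ _ ?N]) (auto intro: minus_carrier_mat)
    also have "\<dots> = (?P k * ?P l - ?P k * ?J) - (?J * ?P l - ?J * ?J)"
      by (simp only: mult_minus_distrib_mat[OF proj_mat_carrier proj_mat_carrier mean_mat_carrier]
          mult_minus_distrib_mat[OF mean_mat_carrier proj_mat_carrier mean_mat_carrier])
    also have "\<dots> = ?P k * ?P l - ?J"
      by (simp add: proj_mat_mult_mean, intro eq_matI) auto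
    finally show ?thesis by (simp add: proj_mat_mult)
  qed
  have PJ: "(?P k - ?J) * ?J = 0\<^sub>m ?N ?N" "?J * (?P k - ?J) = 0\<^sub>m ?N ?N" for k
    by (simp_all add: minus_mult_distrib_mat[OF proj_mat_carrier mean_mat_carrier mean_mat_carrier]
        mult_minus_distrib_mat[OF mean_mat_carrier proj_mat_carrier mean_mat_carrier] proj_mat_mult_mean)
  show "effect_proj r n k * effect_proj r n l = (if k = l then effect_proj r n k else 0\<^sub>m ?N ?N)"
    using kl PP PJ by (auto simp: effect_proj_def)
qed simp

lemma crossed_proj_complete:
  assumes "0 < r"
  shows "complete_orthogonal_projections (n_total r n) {..r} (crossed_proj r n)"
proof -
  interpret orthogonal_projections "n_total r n" "insert r {..<r - 1}" "effect_proj r n"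
    by (rule effect_proj_orthogonal)
  have "insert (r - 1) (insert r {..<r - 1}) = {..r}" using assms by auto
  then show ?thesis
    unfolding crossed_proj_def using complement[of "r - 1"] assms by simp
qed

lemma sum_atMost_crossed:
  fixes g :: "nat \<Rightarrow> real"
  assumes "0 < r"
  shows "(\<Sum>k\<le>r. g k) = (\<Sum>k<r - 1. g k) + g (r - 1) + g r"
proof -
  obtain m where "r = Suc m" using assms by (cases r) auto
  then show ?thesis by (simp add: lessThan_Suc_atMost[symmetric])
qed

lemma index_foldr_add_mat:
  assumes "\<And>x. x \<in> set xs \<Longrightarrow> f x \<in> carrier_mat p q" "A \<in> carrier_mat p q"
  shows "foldr (+) (map f xs) A \<in> carrier_mat p q \<and>
    (\<forall>i<p. \<forall>j<q. foldr (+) (map f xs) A $$ (i, j) = (\<Sum>x\<leftarrow>xs. f x $$ (i, j)) + A $$ (i, j))"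
  using assms by (induction xs) (auto simp: add.assoc)

text \<open>
  Substitute P_j = (P_j - J) + J and the resolution of the identity into the definition of \<Sigma>(v), and
  collect the coefficient of each projection.
\<close>

lemma Sigma_mat_eq_comb:
  assumes "0 < r"
  shows "Sigma_mat r n v = mat_comb (n_total r n) {..r} (crossed_proj r n) (crossed_eigenvalue r n v)"
proof (rule eq_matI)
  let ?N = "n_total r n" let ?c = "\<lambda>j. v $ j * real (n_except r n j)"
  note fold = index_foldr_add_mat[where p = ?N and q = ?N and xs = "[0..<r - 1]"
      and f = "\<lambda>j. ?c j \<cdot>\<^sub>m proj_mat r n j" and A = "v $ (r - 1) \<cdot>\<^sub>m 1\<^sub>m ?N"]
  have carrier: "Sigma_mat r n v \<in> carrier_mat ?N ?N"
    unfolding Sigma_mat_def using fold by (simp add: smult_carrier_mat)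
  then show "dim_row (Sigma_mat r n v) = dim_row (mat_comb ?N {..r} (crossed_proj r n) (crossed_eigenvalue r n v))"
    "dim_col (Sigma_mat r n v) = dim_col (mat_comb ?N {..r} (crossed_proj r n) (crossed_eigenvalue r n v))"
    by auto
  fix i l assume "i < dim_row (mat_comb ?N {..r} (crossed_proj r n) (crossed_eigenvalue r n v))"
    "l < dim_col (mat_comb ?N {..r} (crossed_proj r n) (crossed_eigenvalue r n v))"
  then have il: "i < ?N" "l < ?N" by auto
  define p where "p j = proj_mat r n j $$ (i, l)" for j
  define p0 where "p0 = mean_mat ?N $$ (i, l)"
  define \<delta> :: real where "\<delta> = 1\<^sub>m ?N $$ (i, l)"
  let ?s = "v $ (r - 1)"
  have dims [simp]: "dim_row (mean_mat ?N) = ?N" "dim_col (mean_mat ?N) = ?N"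
    "dim_row (proj_mat r n j) = ?N" "dim_col (proj_mat r n j) = ?N" for j
    using mean_mat_carrier[of ?N] proj_mat_carrier[of r n j] by (blast dest: carrier_matD)+
  have "Sigma_mat r n v $$ (i, l) = (\<Sum>j\<leftarrow>[0..<r - 1]. ?c j * p j) + ?s * \<delta>"
    unfolding Sigma_mat_def using fold il by (simp add: p_def \<delta>_def)
  also have "(\<Sum>j\<leftarrow>[0..<r - 1]. ?c j * p j) = (\<Sum>j<r - 1. ?c j * p j)"
    by (simp add: sum_list_distinct_conv_sum_set atLeast0LessThan)
  finally have lhs: "Sigma_mat r n v $$ (i, l) = (\<Sum>j<r - 1. ?c j * p j) + ?s * \<delta>" .
  have effect_proj_mean: "effect_proj r n r = mean_mat ?N" by (auto simp: effect_proj_def)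
  have E1: "crossed_proj r n k $$ (i, l) = p k - p0" if "k < r - 1" for k
    using that il by (simp add: crossed_proj_def effect_proj_def p_def p0_def)
  have E2: "crossed_proj r n r $$ (i, l) = p0"
    using assms by (auto simp: crossed_proj_def effect_proj_mean p0_def)
  have E3: "crossed_proj r n (r - 1) $$ (i, l) = \<delta> - ((\<Sum>k<r - 1. p k - p0) + p0)"
  proof -
    have "(\<Sum>k<r - 1. effect_proj r n k $$ (i, l)) = (\<Sum>k<r - 1. p k - p0)"
      using il by (intro sum.cong) (auto simp: effect_proj_def p_def p0_def)
    then show ?thesis
      using il assms by (simp add: crossed_proj_def \<delta>_def p0_def effect_proj_mean)
  qed
  have "(\<Sum>k\<le>r. crossed_eigenvalue r n v k * crossed_proj r n k $$ (i, l))
      = (\<Sum>k<r - 1. (?c k + ?s) * (p k - p0)) + ?s * (\<delta> - ((\<Sum>k<r - 1. p k - p0) + p0))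
        + ((\<Sum>k<r - 1. ?c k) + ?s) * p0"
    unfolding sum_atMost_crossed[OF assms] using assms
    by (auto simp add: E1 E2 E3 crossed_eigenvalue_def simp del: One_nat_def)
  also have "(\<Sum>k<r - 1. (?c k + ?s) * (p k - p0))
      = (\<Sum>k<r - 1. ?c k * p k) - (\<Sum>k<r - 1. ?c k) * p0 + ?s * (\<Sum>k<r - 1. p k - p0)"
    unfolding sum_distrib_left sum_distrib_right sum_subtractf[symmetric] sum.distrib[symmetric]
    by (intro sum.cong refl) (simp add: algebra_simps)
  finally have "(\<Sum>k\<le>r. crossed_eigenvalue r n v k * crossed_proj r n k $$ (i, l))
      = (\<Sum>j<r - 1. ?c j * p j) + ?s * \<delta>"
    by (simp add: algebra_simps)
  then show "Sigma_mat r n v $$ (i, l)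
      = mat_comb ?N {..r} (crossed_proj r n) (crossed_eigenvalue r n v) $$ (i, l)"
    using lhs il by simp
qed

lemma mat_trace_crossed_proj:
  assumes pos: "\<And>i. i < r - 1 \<Longrightarrow> 0 < n i" and r: "0 < r"
  shows "k < r - 1 \<Longrightarrow> mat_trace (crossed_proj r n k) = real (n k) - 1"
    and "mat_trace (crossed_proj r n (r - 1)) = n_tilde r n"
    and "mat_trace (crossed_proj r n r) = 1"
proof -
  let ?N = "n_total r n"
  interpret orthogonal_projections ?N "insert r {..<r - 1}" "effect_proj r n"
    by (rule effect_proj_orthogonal)
  have N: "0 < ?N" using pos by (simp add: n_total_def)
  have eff: "mat_trace (effect_proj r n k) = real (n k) - 1" if "k < r - 1" for k
    using that by (simp add: effect_proj_def mat_trace_minus[OF proj_mat_carrier mean_mat_carrier]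
        mat_trace_proj_mat pos N)
  have mean: "mat_trace (effect_proj r n r) = 1" by (simp add: effect_proj_def N)
  show "k < r - 1 \<Longrightarrow> mat_trace (crossed_proj r n k) = real (n k) - 1"
    by (simp add: crossed_proj_def eff)
  show "mat_trace (crossed_proj r n r) = 1"
    using r by (simp add: crossed_proj_def mean)
  have "mat_trace (mat_comb ?N (insert r {..<r - 1}) (effect_proj r n) (\<lambda>_. 1))
      = 1 + (\<Sum>j<r - 1. real (n j) - 1)"
    by (subst mat_trace_mat_comb) (auto simp: mean eff intro: carrier)
  then show "mat_trace (crossed_proj r n (r - 1)) = n_tilde r n"
    by (simp add: crossed_proj_def mat_trace_minus[OF one_carrier_mat mat_comb_carrier] n_tilde_def)
qed

section \<open>Contrasts\<close>

text \<open>
  Appending the normalised constant column to V gives a square matrix W with W^T W = I. A one-sided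
  inverse of a square matrix is two-sided, and W W^T = V V^T + J.
\<close>

lemma contrast_basis_mult_transpose:
  assumes V: "contrast_basis N V" and N: "0 < N"
  shows "V * transpose_mat V = 1\<^sub>m N - mean_mat N"
proof -
  have Vc: "V \<in> carrier_mat N (N - 1)" and VV: "transpose_mat V * V = 1\<^sub>m (N - 1)"
    and V1: "transpose_mat V *\<^sub>v ones_vec N = 0\<^sub>v (N - 1)"
    using V by (auto simp: contrast_basis_def)
  have Vt: "transpose_mat V \<in> carrier_mat (N - 1) N" using Vc by simp
  define W where "W = mat N N (\<lambda>(i, j). if j < N - 1 then V $$ (i, j) else 1 / sqrt (real N))"
  have W: "W \<in> carrier_mat N N" and Wt: "transpose_mat W \<in> carrier_mat N N" by (auto simp: W_def)
  have Wi: "W $$ (i, j) = (if j < N - 1 then V $$ (i, j) else 1 / sqrt (real N))" if "i < N" "j < N" for i j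
    using that by (simp add: W_def)
  have dV [simp]: "dim_row V = N" "dim_col V = N - 1" "dim_row W = N" "dim_col W = N"
    using Vc W by auto
  have gram: "(\<Sum>t<N. V $$ (t, i) * V $$ (t, j)) = (if i = j then 1 else 0)" if "i < N - 1" "j < N - 1" for i j
  proof -
    have "(transpose_mat V * V) $$ (i, j) = (\<Sum>t<N. V $$ (t, i) * V $$ (t, j))"
      unfolding index_mult_mat_sum[OF Vt Vc that] using that by (intro sum.cong) auto
    then show ?thesis unfolding VV using that by simp
  qed
  have colsum: "(\<Sum>t<N. V $$ (t, i)) = 0" if "i < N - 1" for i
  proof -
    have "(transpose_mat V *\<^sub>v ones_vec N) $ i = (\<Sum>t<N. V $$ (t, i))"
      using that by (auto simp: ones_vec_def scalar_prod_def atLeast0LessThan intro!: sum.cong)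
    then show ?thesis unfolding V1 using that by simp
  qed
  have "transpose_mat W * W = 1\<^sub>m N"
  proof (rule eq_matI)
    fix i j assume "i < dim_row (1\<^sub>m N :: real mat)" "j < dim_col (1\<^sub>m N :: real mat)"
    then have ij: "i < N" "j < N" by auto
    have "(transpose_mat W * W) $$ (i, j) = (\<Sum>t<N. W $$ (t, i) * W $$ (t, j))"
      unfolding index_mult_mat_sum[OF Wt W ij] using ij by (intro sum.cong) auto
    also have "\<dots> = (if i = j then 1 else 0)"
    proof -
      consider "i < N - 1" "j < N - 1" | "i < N - 1" "j = N - 1" | "i = N - 1" "j < N - 1" | "i = N - 1" "j = N - 1"
        using ij by linarith
      then show ?thesis
      proof cases
        case 1 then show ?thesis using ij gram by (simp add: Wi)
      next
        case 2 then show ?thesis using ij colsum[of i] by (simp add: Wi flip: sum_divide_distrib)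
      next
        case 3 then show ?thesis using ij colsum[of j] by (simp add: Wi flip: sum_divide_distrib)
      next
        case 4 then show ?thesis using N by (simp add: Wi)
      qed
    qed
    finally show "(transpose_mat W * W) $$ (i, j) = 1\<^sub>m N $$ (i, j)" using ij by simp
  qed auto
  then have WW: "W * transpose_mat W = 1\<^sub>m N"
    using mat_mult_left_right_inverse[OF Wt W] by simp
  show ?thesis
  proof (rule eq_matI)
    fix i j assume "i < dim_row (1\<^sub>m N - mean_mat N)" "j < dim_col (1\<^sub>m N - mean_mat N)"
    then have ij: "i < N" "j < N" by (auto simp: mean_mat_def)
    have "(V * transpose_mat V) $$ (i, j) = (\<Sum>t<N - 1. V $$ (i, t) * V $$ (j, t))"
      unfolding index_mult_mat_sum[OF Vc Vt ij] using ij by (intro sum.cong) auto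
    also have "\<dots> = (\<Sum>t<N - 1. W $$ (i, t) * W $$ (j, t))"
      using ij by (intro sum.cong) (auto simp: Wi)
    also have "\<dots> = (\<Sum>t<N. W $$ (i, t) * W $$ (j, t)) - W $$ (i, N - 1) * W $$ (j, N - 1)"
      using N by (cases N) auto
    also have "(\<Sum>t<N. W $$ (i, t) * W $$ (j, t)) = (W * transpose_mat W) $$ (i, j)"
      unfolding index_mult_mat_sum[OF W Wt ij] using ij by (intro sum.cong) auto
    also have "\<dots> = 1\<^sub>m N $$ (i, j)" unfolding WW ..
    also have "W $$ (i, N - 1) * W $$ (j, N - 1) = mean_mat N $$ (i, j)"
      using ij by (simp add: Wi mean_mat_def)
    finally show "(V * transpose_mat V) $$ (i, j) = (1\<^sub>m N - mean_mat N) $$ (i, j)"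
      using ij by (simp add: mean_mat_def)
  qed (auto simp: mean_mat_def)
qed

lemma contrast_basis_mult_mean:
  assumes V: "contrast_basis N V"
  shows "transpose_mat V * mean_mat N = 0\<^sub>m (N - 1) N" "mean_mat N * V = 0\<^sub>m N (N - 1)"
proof -
  have Vc: "V \<in> carrier_mat N (N - 1)" and V1: "transpose_mat V *\<^sub>v ones_vec N = 0\<^sub>v (N - 1)"
    using V by (auto simp: contrast_basis_def)
  have Vt: "transpose_mat V \<in> carrier_mat (N - 1) N" using Vc by simp
  show 1: "transpose_mat V * mean_mat N = 0\<^sub>m (N - 1) N"
  proof (rule eq_matI)
    fix i j assume "i < dim_row (0\<^sub>m (N - 1) N :: real mat)" "j < dim_col (0\<^sub>m (N - 1) N :: real mat)"
    then have ij: "i < N - 1" "j < N" by auto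
    have "(transpose_mat V * mean_mat N) $$ (i, j) = (\<Sum>t<N. V $$ (t, i) / real N)"
      unfolding index_mult_mat_sum[OF Vt mean_mat_carrier ij] using ij Vc
      by (intro sum.cong) (auto simp: mean_mat_def)
    also have "\<dots> = (transpose_mat V *\<^sub>v ones_vec N) $ i / real N"
      using ij Vc by (auto simp: ones_vec_def scalar_prod_def atLeast0LessThan sum_divide_distrib intro!: sum.cong)
    finally show "(transpose_mat V * mean_mat N) $$ (i, j) = 0\<^sub>m (N - 1) N $$ (i, j)"
      unfolding V1 using ij by simp
  qed (use Vc in \<open>auto simp: mean_mat_def\<close>)
  have "mean_mat N * V = transpose_mat (transpose_mat V * mean_mat N)"
    using transpose_mult[OF Vt mean_mat_carrier] by simp
  then show "mean_mat N * V = 0\<^sub>m N (N - 1)" unfolding 1 by simp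
qed

text \<open>
  The product of two compressions contains V V^T = I - J between E k and E l, and J disappears there
  because E k J = 0. The same identity and the cyclicity of the trace preserve the traces.
\<close>

lemma (in complete_orthogonal_projections) contrasts:
  assumes K: "K = insert k0 K'" "k0 \<notin> K'" and mean: "E k0 = mean_mat N"
    and V: "contrast_basis N V" and N: "0 < N"
  shows "complete_orthogonal_projections (N - 1) K' (\<lambda>k. transpose_mat V * E k * V)"
    and "k \<in> K' \<Longrightarrow> mat_trace (transpose_mat V * E k * V) = mat_trace (E k)"
    and "transpose_mat V * comb f * V = mat_comb (N - 1) K' (\<lambda>k. transpose_mat V * E k * V) f"
proof -
  let ?F = "\<lambda>k. transpose_mat V * E k * V"
  have Vc: "V \<in> carrier_mat N (N - 1)" and VV: "transpose_mat V * V = 1\<^sub>m (N - 1)"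
    using V by (auto simp: contrast_basis_def)
  have Vt: "transpose_mat V \<in> carrier_mat (N - 1) N" using Vc by simp
  have in_K: "k \<in> K" "k \<noteq> k0" if "k \<in> K'" for k using that K by auto
  have k0: "k0 \<in> K" using K by simp
  have F: "?F k \<in> carrier_mat (N - 1) (N - 1)" if "k \<in> K" for k
    using Vt Vc carrier[OF that] by auto
  have F0: "?F k0 = 0\<^sub>m (N - 1) (N - 1)"
    using Vc by (simp add: mean contrast_basis_mult_mean[OF V])
  have EVV: "E k * (V * transpose_mat V) = E k" if "k \<in> K'" for k
  proof -
    have "E k * (V * transpose_mat V) = E k * 1\<^sub>m N - E k * mean_mat N"
      unfolding contrast_basis_mult_transpose[OF V N]
      using in_K[OF that] by (intro mult_minus_distrib_mat) auto
    also have "E k * mean_mat N = 0\<^sub>m N N"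
      using prod[OF in_K(1)[OF that] k0] in_K[OF that] by (simp add: mean)
    finally show ?thesis
      unfolding right_mult_one_mat[OF carrier[OF in_K(1)[OF that]]]
      using carrier[OF in_K(1)[OF that]] by (intro eq_matI) auto
  qed
  show trace: "mat_trace (?F k) = mat_trace (E k)" if "k \<in> K'" for k
  proof -
    note Ek = carrier[OF in_K(1)[OF that]]
    have "mat_trace (?F k) = mat_trace (transpose_mat V * (E k * V))"
      using Vt Ek Vc by (simp add: assoc_mult_mat)
    also have "\<dots> = mat_trace ((E k * V) * transpose_mat V)"
      using Vt Ek Vc by (intro mat_trace_comm[of _ "N - 1" N]) auto
    also have "(E k * V) * transpose_mat V = E k * (V * transpose_mat V)"
      using Vt Ek Vc by (intro assoc_mult_mat) auto
    finally show ?thesis by (simp add: EVV[OF that])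
  qed
  show comb: "transpose_mat V * comb f * V = mat_comb (N - 1) K' ?F f" for f
  proof -
    have "transpose_mat V * comb f * V = mat_comb (N - 1) K ?F f"
      using Vt Vc by (intro mat_comb_conj) auto
    also have "\<dots> = mat_comb (N - 1) K' ?F f"
    proof (rule eq_matI)
      fix i j assume "i < dim_row (mat_comb (N - 1) K' ?F f)" "j < dim_col (mat_comb (N - 1) K' ?F f)"
      then have ij: "i < N - 1" "j < N - 1" by auto
      have "(\<Sum>k\<in>K. f k * ?F k $$ (i, j)) = f k0 * ?F k0 $$ (i, j) + (\<Sum>k\<in>K'. f k * ?F k $$ (i, j))"
        using K finite by simp
      also have "?F k0 $$ (i, j) = 0" unfolding F0 using ij by simp
      finally show "mat_comb (N - 1) K ?F f $$ (i, j) = mat_comb (N - 1) K' ?F f $$ (i, j)"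
        using ij by (simp del: index_mult_mat(1))
    qed auto
    finally show ?thesis .
  qed
  show "complete_orthogonal_projections (N - 1) K' ?F"
  proof
    show "finite K'" using finite K by simp
    show "?F k \<in> carrier_mat (N - 1) (N - 1)" if "k \<in> K'" for k using F in_K[OF that] by simp
    show "transpose_mat (?F k) = ?F k" if "k \<in> K'" for k
    proof -
      note Ek = carrier[OF in_K(1)[OF that]]
      have "transpose_mat (?F k) = transpose_mat V * transpose_mat (transpose_mat V * E k)"
        using Vt Ek Vc by (intro transpose_mult) auto
      also have "transpose_mat (transpose_mat V * E k) = E k * V"
        using transpose_mult[OF Vt Ek] symmetric[OF in_K(1)[OF that]] by simp
      also have "transpose_mat V * (E k * V) = ?F k"
        using Vt Ek Vc by (intro assoc_mult_mat[symmetric]) auto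
      finally show ?thesis .
    qed
    show "?F k * ?F l = (if k = l then ?F k else 0\<^sub>m (N - 1) (N - 1))" if k: "k \<in> K'" and l: "l \<in> K'" for k l
    proof -
      note Ek = carrier[OF in_K(1)[OF k]] and El = carrier[OF in_K(1)[OF l]]
      have VE: "transpose_mat V * E k \<in> carrier_mat (N - 1) N" using Vt Ek by auto
      have EV: "E l * V \<in> carrier_mat N (N - 1)" using Vc El by auto
      have "?F k * ?F l = (transpose_mat V * E k * V) * (transpose_mat V * (E l * V))"
        using Vt El Vc by (simp add: assoc_mult_mat)
      also have "\<dots> = (transpose_mat V * E k * V * transpose_mat V) * (E l * V)"
        using Vt VE Vc EV by (intro assoc_mult_mat[symmetric]) auto
      also have "transpose_mat V * E k * V * transpose_mat V = transpose_mat V * E k * (V * transpose_mat V)"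
        using Vt VE Vc by (intro assoc_mult_mat) auto
      also have "\<dots> = transpose_mat V * (E k * (V * transpose_mat V))"
        using Vt Ek Vc by (intro assoc_mult_mat) auto
      also have "\<dots> = transpose_mat V * E k" by (simp add: EVV[OF k])
      also have "transpose_mat V * E k * (E l * V) = transpose_mat V * E k * E l * V"
        using VE El Vc by (intro assoc_mult_mat[symmetric]) auto
      also have "transpose_mat V * E k * E l = transpose_mat V * (E k * E l)"
        using Vt Ek El by (intro assoc_mult_mat) auto
      finally have "?F k * ?F l = transpose_mat V * (E k * E l) * V" .
      then show ?thesis using prod[OF in_K(1)[OF k] in_K(1)[OF l]] Vt Vc by simp
    qed
    have "mat_comb (N - 1) K' ?F (\<lambda>_. 1) = transpose_mat V * 1\<^sub>m N * V"
      using comb[of "\<lambda>_. 1"] by (simp add: complete)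
    also have "\<dots> = 1\<^sub>m (N - 1)" using right_mult_one_mat[OF Vt] VV by simp
    finally show "mat_comb (N - 1) K' ?F (\<lambda>_. 1) = 1\<^sub>m (N - 1)" .
  qed
qed

section \<open>Bounds on the eigenvalue ratios\<close>

text \<open>
  For two factors the product exceeds 1 + x 0 + x 1 by x 0 * x 1, which is at least c squared, and a
  further factor 1 + x m multiplies a number that is at least one, so it adds at least x m. With
  x j = n j - 1 this bounds the residual degrees of freedom from below.
\<close>

lemma prod_minus_sum_ge_square:
  fixes x :: "nat \<Rightarrow> real"
  assumes c: "0 \<le> c" and x: "\<And>j. j < m \<Longrightarrow> c \<le> x j" and m: "2 \<le> m"
  shows "1 + (\<Sum>j<m. x j) + c\<^sup>2 \<le> (\<Prod>j<m. 1 + x j)"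
  using m x
proof (induction m rule: dec_induct)
  case base
  have "c \<le> x 0" "c \<le> x 1" using base by auto
  then have "c * c \<le> x 0 * x 1" using c by (intro mult_mono) auto
  then show ?case by (simp add: numeral_2_eq_2 power2_eq_square algebra_simps)
next
  case (step m)
  have IH: "1 + (\<Sum>j<m. x j) + c\<^sup>2 \<le> (\<Prod>j<m. 1 + x j)" using step by simp
  have xm: "0 \<le> x m" using step.prems[of m] c by simp
  have "0 \<le> (\<Sum>j<m. x j)"
  proof (intro sum_nonneg)
    fix j assume "j \<in> {..<m}"
    then show "0 \<le> x j" using step.prems[of j] c by simp
  qed
  moreover have "0 \<le> c\<^sup>2" by simp
  ultimately have "1 \<le> (\<Prod>j<m. 1 + x j)" using IH by linarith
  then have "x m \<le> (\<Prod>j<m. 1 + x j) * x m" using xm by (simp add: mult_le_cancel_right1)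
  then show ?case using IH by (simp add: algebra_simps)
qed

lemma n_tilde_ge_square:
  assumes "0 \<le> c" "\<And>j. j < r - 1 \<Longrightarrow> 1 + c \<le> real (n j)" "3 \<le> r"
  shows "c\<^sup>2 \<le> n_tilde r n"
  using prod_minus_sum_ge_square[of c "r - 1" "\<lambda>j. real (n j) - 1"] assms
  by (simp add: n_tilde_def n_total_def algebra_simps)

lemma weighted_Cauchy_Schwarz:
  fixes w x d :: "'k \<Rightarrow> real"
  assumes "\<And>k. k \<in> K \<Longrightarrow> 0 < d k"
  shows "(\<Sum>k\<in>K. w k * x k)\<^sup>2 \<le> (\<Sum>k\<in>K. (w k)\<^sup>2 / d k) * (\<Sum>k\<in>K. (x k)\<^sup>2 * d k)"
proof -
  have "(\<Sum>k\<in>K. w k * x k) = (\<Sum>k\<in>K. (w k / sqrt (d k)) * (x k * sqrt (d k)))"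
    using assms by (intro sum.cong) (auto simp: less_imp_neq[symmetric])
  also have "\<dots>\<^sup>2 \<le> (\<Sum>k\<in>K. (w k / sqrt (d k))\<^sup>2) * (\<Sum>k\<in>K. (x k * sqrt (d k))\<^sup>2)"
    by (rule Cauchy_Schwarz_ineq_sum)
  also have "\<dots> = (\<Sum>k\<in>K. (w k)\<^sup>2 / d k) * (\<Sum>k\<in>K. (x k)\<^sup>2 * d k)"
    using assms by (intro arg_cong2[where f = "(*)"] sum.cong)
      (auto simp: power_divide power_mult_distrib less_imp_le)
  finally show ?thesis .
qed

text \<open>
  Every main-effect eigenvalue contains the error parameter once, so that their sum counts it r - 1
  times, whereas the eigenvalue of the mean contains it once.
\<close>

lemma crossed_eigenvalue_mean:
  assumes "2 \<le> r"
  shows "crossed_eigenvalue r n v r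
    = (\<Sum>k<r - 1. crossed_eigenvalue r n v k) - (real r - 2) * crossed_eigenvalue r n v (r - 1)"
proof -
  obtain m where "r = Suc m" using assms by (cases r) auto
  then show ?thesis by (simp add: crossed_eigenvalue_def sum.distrib algebra_simps)
qed

lemma crossed_eigenvalue_pos:
  assumes "\<psi> \<in> param_space r"
  shows "0 < crossed_eigenvalue r n \<psi> k"
  using assms by (auto simp: crossed_eigenvalue_def param_space_def intro!: add_nonneg_pos sum_nonneg)

lemma crossed_eigenvalue_le_mean:
  assumes "\<psi> \<in> param_space r" and "0 < r"
  shows "crossed_eigenvalue r n \<psi> k \<le> crossed_eigenvalue r n \<psi> r"
proof -
  have nn: "0 \<le> \<psi> $ j * real (n_except r n j)" if "j < r - 1" for j
    using assms that by (simp add: param_space_def)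
  have "\<psi> $ k * real (n_except r n k) \<le> (\<Sum>j<r - 1. \<psi> $ j * real (n_except r n j))" if "k < r - 1"
    using that nn by (intro member_le_sum) auto
  moreover have "0 \<le> (\<Sum>j<r - 1. \<psi> $ j * real (n_except r n j))" using nn by (intro sum_nonneg) auto
  moreover have "\<not> r < r - 1" "r \<noteq> r - 1" using assms(2) by auto
  ultimately show ?thesis unfolding crossed_eigenvalue_def by auto
qed

text \<open>
  If the error parameter vanishes, the main-effect eigenvalues are the other parameters, rescaled.
\<close>

lemma crossed_eigenvalue_nonzero:
  assumes v: "v \<in> unit_sphere r" and pos: "\<And>j. j < r - 1 \<Longrightarrow> 0 < n j" and r: "0 < r"
  shows "\<exists>k\<le>r - 1. crossed_eigenvalue r n v k \<noteq> 0"
proof (cases "v $ (r - 1) = 0")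
  case False
  then show ?thesis by (intro exI[of _ "r - 1"]) (simp add: crossed_eigenvalue_def)
next
  case True
  have "v \<bullet> v = 1" and vc: "v \<in> carrier_vec r" using v by (auto simp: unit_sphere_def vec_norm_def)
  then have "(\<Sum>k<r. v $ k * v $ k) \<noteq> 0" by (simp add: scalar_prod_def atLeast0LessThan)
  then obtain k where "k \<in> {..<r}" "v $ k * v $ k \<noteq> 0" by (meson sum.neutral)
  then have k: "k < r" "v $ k \<noteq> 0" by auto
  then have "k \<noteq> r - 1" using True by auto
  then have "k < r - 1" using k by linarith
  moreover have "0 < n_except r n k" unfolding n_except_def using pos by (intro prod_pos) auto
  ultimately show ?thesis using k True by (intro exI[of _ k]) (simp add: crossed_eigenvalue_def)
qed

text \<open>
  Dividing the relation between the eigenvalues of \<Sigma>(v) by the eigenvalue of \<Sigma>(\<psi>) on the mean turns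
  it into f r = \<Sum> w k * f k with |w k| \<le> 1 on main effects and |w (r - 1)| \<le> r - 2, since no eigenvalue
  of \<Sigma>(\<psi>) exceeds the one on the mean. Cauchy-Schwarz does the rest.
\<close>

lemma mean_ratio_square_le:
  fixes v \<psi> :: "real vec" and n :: "nat \<Rightarrow> nat"
  assumes r: "3 \<le> r" and \<psi>: "\<psi> \<in> param_space r"
    and n2: "\<And>j. j < r - 1 \<Longrightarrow> 2 \<le> n j"
  defines "f \<equiv> \<lambda>k. crossed_eigenvalue r n v k / crossed_eigenvalue r n \<psi> k"
  shows "(f r)\<^sup>2 \<le> ((\<Sum>j<r - 1. 1 / (real (n j) - 1)) + (real r - 2)\<^sup>2 / n_tilde r n) *
      ((\<Sum>k<r - 1. (f k)\<^sup>2 * (real (n k) - 1)) + (f (r - 1))\<^sup>2 * n_tilde r n)"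
proof -
  let ?L = "crossed_eigenvalue r n \<psi>"
  define d where "d k = (if k < r - 1 then real (n k) - 1 else n_tilde r n)" for k
  define w where "w k = (if k < r - 1 then ?L k / ?L r else - ((real r - 2) * (?L k / ?L r)))" for k
  have "1 + 1 \<le> real (n j)" if "j < r - 1" for j using n2[OF that] by linarith
  then have tilde: "0 < n_tilde r n" using n_tilde_ge_square[of 1 r n] r by simp
  have d: "0 < d k" for k using n2[of k] tilde by (auto simp: d_def)
  have L: "0 < ?L k" "?L k \<le> ?L r" for k
    using crossed_eigenvalue_pos[OF \<psi>] crossed_eigenvalue_le_mean[OF \<psi>] r by auto
  have fL: "f k * ?L k = crossed_eigenvalue r n v k" for k
    using L(1)[of k] by (simp add: f_def)
  have split: "(\<Sum>k\<le>r - 1. g k) = (\<Sum>k<r - 1. g k) + g (r - 1)" for g :: "nat \<Rightarrow> real"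
    by (simp add: lessThan_Suc_atMost[symmetric])
  have "f r = ((\<Sum>k<r - 1. f k * ?L k) - (real r - 2) * (f (r - 1) * ?L (r - 1))) / ?L r"
    unfolding fL using crossed_eigenvalue_mean[of r n v] r by (simp add: f_def)
  also have "\<dots> = (\<Sum>k\<le>r - 1. w k * f k)"
    unfolding split by (simp add: w_def diff_divide_distrib sum_divide_distrib mult_ac)
  finally have "(f r)\<^sup>2 \<le> (\<Sum>k\<le>r - 1. (w k)\<^sup>2 / d k) * (\<Sum>k\<le>r - 1. (f k)\<^sup>2 * d k)"
    using weighted_Cauchy_Schwarz[of "{..r - 1}" d w f] d by simp
  also have "(\<Sum>k\<le>r - 1. (f k)\<^sup>2 * d k) = (\<Sum>k<r - 1. (f k)\<^sup>2 * (real (n k) - 1)) + (f (r - 1))\<^sup>2 * n_tilde r n"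
    unfolding split by (simp add: d_def)
  also have "(\<Sum>k\<le>r - 1. (w k)\<^sup>2 / d k) * \<dots> \<le>
      ((\<Sum>j<r - 1. 1 / (real (n j) - 1)) + (real r - 2)\<^sup>2 / n_tilde r n) * \<dots>"
  proof (rule mult_right_mono)
    have q: "(?L k / ?L r)\<^sup>2 \<le> 1" for k
      using L[of k] L(1)[of r] by (intro power_le_one) auto
    have "(\<Sum>k<r - 1. (w k)\<^sup>2 / d k) \<le> (\<Sum>j<r - 1. 1 / (real (n j) - 1))"
    proof (intro sum_mono)
      fix k assume "k \<in> {..<r - 1}"
      then show "(w k)\<^sup>2 / d k \<le> 1 / (real (n k) - 1)"
        using q[of k] d[of k] by (simp add: w_def d_def divide_right_mono)
    qed
    moreover have "(w (r - 1))\<^sup>2 / d (r - 1) \<le> (real r - 2)\<^sup>2 / n_tilde r n"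
    proof -
      have "(w (r - 1))\<^sup>2 = (real r - 2)\<^sup>2 * (?L (r - 1) / ?L r)\<^sup>2"
        unfolding w_def by (simp only: power_mult_distrib power2_minus less_irrefl if_False)
      also have "\<dots> \<le> (real r - 2)\<^sup>2" using q by (intro mult_left_le) auto
      finally show ?thesis using tilde by (simp add: d_def divide_right_mono)
    qed
    ultimately show "(\<Sum>k\<le>r - 1. (w k)\<^sup>2 / d k)
        \<le> (\<Sum>j<r - 1. 1 / (real (n j) - 1)) + (real r - 2)\<^sup>2 / n_tilde r n"
      unfolding split by (rule add_mono)
    show "0 \<le> (\<Sum>k<r - 1. (f k)\<^sup>2 * (real (n k) - 1)) + (f (r - 1))\<^sup>2 * n_tilde r n"
    proof (intro add_nonneg_nonneg sum_nonneg)
      fix k assume "k \<in> {..<r - 1}"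
      then show "0 \<le> (f k)\<^sup>2 * (real (n k) - 1)" using n2[of k] by simp
    qed (use tilde in simp)
  qed
  finally show ?thesis .
qed

lemma square_le_of_weight:
  fixes x d c F :: real
  assumes "0 < d" "1 / d \<le> c" "x\<^sup>2 * d \<le> F"
  shows "x\<^sup>2 \<le> c * F"
proof -
  have "x\<^sup>2 = 1 / d * (x\<^sup>2 * d)" using assms by simp
  also have "\<dots> \<le> c * F"
    using assms by (intro mult_mono) (auto intro: order_trans[of 0 "1 / d"])
  finally show ?thesis .
qed

text \<open>
  This form serves the full design (K = {..r}) and the contrasts (K = {..r - 1}) alike: a unit vector v
  already has a nonzero eigenvalue among the indices up to r - 1, so in both cases the Frobenius norm is
  positive and the quotient is not set to its default 1.
\<close>

lemma norm_ratio_standardized_le: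
  fixes v \<psi> :: "real vec" and n :: "nat \<Rightarrow> nat"
  assumes cop: "complete_orthogonal_projections N K E" and K: "{..r - 1} \<subseteq> K" and r: "0 < r"
    and d: "\<And>k. k \<in> K \<Longrightarrow> mat_trace (E k) = d k" "\<And>k. k \<in> K \<Longrightarrow> 0 < d k"
    and pos: "\<And>j. j < r - 1 \<Longrightarrow> 0 < n j"
    and v: "v \<in> unit_sphere r" and \<psi>: "\<psi> \<in> param_space r" and c: "0 \<le> c"
    and bound: "\<And>k. k \<in> K \<Longrightarrow> (crossed_eigenvalue r n v k / crossed_eigenvalue r n \<psi> k)\<^sup>2
      \<le> c * (\<Sum>l\<in>K. (crossed_eigenvalue r n v l / crossed_eigenvalue r n \<psi> l)\<^sup>2 * d l)"
  defines "S \<equiv> \<lambda>u. mat_comb N K E (crossed_eigenvalue r n u)"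
  shows "(norm_ratio (inv_sqrt_mat (S \<psi>) * S v * inv_sqrt_mat (S \<psi>)))\<^sup>2 \<le> c"
proof -
  interpret complete_orthogonal_projections N K E by (rule cop)
  let ?f = "\<lambda>k. crossed_eigenvalue r n v k / crossed_eigenvalue r n \<psi> k"
  have sum_eq: "(\<Sum>l\<in>K. (?f l)\<^sup>2 * mat_trace (E l)) = (\<Sum>l\<in>K. (?f l)\<^sup>2 * d l)"
    by (simp add: d(1))
  have "\<exists>k\<le>r - 1. crossed_eigenvalue r n v k \<noteq> 0"
    using pos by (rule crossed_eigenvalue_nonzero[OF v _ r])
  then obtain k where k: "k \<in> K" "crossed_eigenvalue r n v k \<noteq> 0"
    using K by auto
  have "0 < (?f k)\<^sup>2 * d k"
    using k d(2) crossed_eigenvalue_pos[OF \<psi>, of n k] by simp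
  also have "\<dots> \<le> (\<Sum>l\<in>K. (?f l)\<^sup>2 * d l)"
    using k d(2) finite by (intro member_le_sum) (auto simp: less_imp_le)
  finally have "(norm_ratio (comb ?f))\<^sup>2 \<le> c"
    using bound c by (intro norm_ratio_comb_le) (simp_all add: sum_eq)
  then show ?thesis
    unfolding S_def using standardized_comb crossed_eigenvalue_pos[OF \<psi>] by simp
qed

section \<open>Bounds on the norm ratios\<close>

theorem theorem4:
  fixes r :: nat and n :: "nat \<Rightarrow> nat"
    and M :: "'w measure" and Y :: "'w \<Rightarrow> real vec" and \<beta> :: real and \<psi>\<^sub>0 :: "real vec"
  assumes "\<forall>j<r - 1. 0 < n j"
    and "\<psi>\<^sub>0 \<in> param_space r"
    and "multivariate_normal M (n_total r n) Y (\<beta> \<cdot>\<^sub>v ones_vec (n_total r n)) (Sigma_mat r n \<psi>\<^sub>0)"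
    and "3 \<le> r"
    and "2 \<le> n_min r n"
  shows "\<forall>v\<in>unit_sphere r. \<forall>\<psi>\<in>param_space r.
      (a_ratio r n v \<psi>)\<^sup>2
        \<le> (\<Sum>j<r - 1. 1 / (real (n j) - 1)) + (real r - 2)\<^sup>2 / n_tilde r n \<and>
      (\<Sum>j<r - 1. 1 / (real (n j) - 1)) + (real r - 2)\<^sup>2 / n_tilde r n
        \<le> (real r - 1) / (real (n_min r n) - 1) + (real r - 2)\<^sup>2 / n_tilde r n \<and>
      (3 \<le> n_min r n \<longrightarrow>
        (\<forall>V. contrast_basis (n_total r n) V \<longrightarrow>
          (a_tilde r n V v \<psi>)\<^sup>2
            \<le> max (inverse (real (n_min r n) - 2)) (inverse (n_tilde r n - 1))))"
proof (intro ballI conjI impI allI)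
  fix v \<psi> assume v: "v \<in> unit_sphere r" and \<psi>: "\<psi> \<in> param_space r"
  have r: "3 \<le> r" "0 < r" "r - 1 \<noteq> r" using assms(4) by auto
  have pos: "0 < n j" if "j < r - 1" for j using assms(1) that by simp
  have min_le: "n_min r n \<le> n j" if "j < r - 1" for j
    using that by (auto simp: n_min_def intro!: Min_le)
  have n2: "2 \<le> n j" if "j < r - 1" for j using min_le[OF that] assms(5) by simp
  have "1 + 1 \<le> real (n j)" if "j < r - 1" for j using n2[OF that] by linarith
  then have tilde: "1 \<le> n_tilde r n" using n_tilde_ge_square[of 1 r n] r(1) by simp
  have N: "0 < n_total r n" using pos by (simp add: n_total_def)
  let ?f = "\<lambda>k. crossed_eigenvalue r n v k / crossed_eigenvalue r n \<psi> k"
  define d where "d k = (if k < r - 1 then real (n k) - 1 else if k = r - 1 then n_tilde r n else 1)" for k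
  have d: "0 < d k" for k using n2[of k] tilde by (auto simp: d_def)
  have index_cases: "k < r - 1 \<or> k = r - 1 \<or> k = r" if "k \<le> r" for k
    using that by linarith
  have trace: "mat_trace (crossed_proj r n k) = d k" if k: "k \<le> r" for k
  proof -
    consider "k < r - 1" | "k = r - 1" | "k = r" using index_cases[OF k] by blast
    then show ?thesis using mat_trace_crossed_proj[where n = n, OF pos r(2)] r(2,3) by cases (auto simp: d_def)
  qed
  note cop = crossed_proj_complete[OF r(2), of n]
  define c where "c = (\<Sum>j<r - 1. 1 / (real (n j) - 1)) + (real r - 2)\<^sup>2 / n_tilde r n"
  have sum_nn: "0 \<le> 1 / (real (n j) - 1)" if "j < r - 1" for j using n2[OF that] by simp
  then have c0: "0 \<le> (\<Sum>j<r - 1. 1 / (real (n j) - 1))" by (intro sum_nonneg) auto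
  then have c: "0 \<le> c" unfolding c_def using tilde by (intro add_nonneg_nonneg) auto
  show "(a_ratio r n v \<psi>)\<^sup>2 \<le> (\<Sum>j<r - 1. 1 / (real (n j) - 1)) + (real r - 2)\<^sup>2 / n_tilde r n"
    unfolding a_ratio_def A_mat_def Sigma_mat_eq_comb[OF r(2)] c_def[symmetric]
  proof (rule norm_ratio_standardized_le[OF cop _ r(2) trace d pos v \<psi> c])
    fix k assume "k \<in> {..r}"
    let ?F = "\<Sum>l\<le>r. (?f l)\<^sup>2 * d l"
    have term_le: "(?f k)\<^sup>2 * d k \<le> ?F" if "k \<le> r" for k
      using that d by (intro member_le_sum) (auto simp: less_imp_le)
    consider "k < r - 1" | "k = r - 1" | "k = r"
      using index_cases[of k] \<open>k \<in> {..r}\<close> by auto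
    then show "(?f k)\<^sup>2 \<le> c * ?F"
    proof cases
      case 1
      have "1 / d k \<le> (\<Sum>j<r - 1. 1 / (real (n j) - 1))"
        using 1 sum_nn member_le_sum[of k "{..<r - 1}" "\<lambda>j. 1 / (real (n j) - 1)"] by (simp add: d_def)
      also have "\<dots> \<le> c" using tilde by (simp add: c_def)
      finally show ?thesis using 1 d term_le by (intro square_le_of_weight[of "d k"]) auto
    next
      case 2
      \<comment> \<open>The residual term of c has numerator at least 1, because r is at least 3.\<close>
      have "1 \<le> (real r - 2)\<^sup>2" using r(1) by (intro one_le_power) auto
      then have "1 / d k \<le> (real r - 2)\<^sup>2 / n_tilde r n"
        using 2 tilde by (simp add: d_def divide_right_mono)
      also have "\<dots> \<le> c" using c0 by (simp add: c_def)
      finally show ?thesis using 2 d term_le by (intro square_le_of_weight[of "d k"]) auto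
    next
      case 3
      have "(?f r)\<^sup>2 \<le> c * ((\<Sum>k<r - 1. (?f k)\<^sup>2 * (real (n k) - 1)) + (?f (r - 1))\<^sup>2 * n_tilde r n)"
        unfolding c_def by (rule mean_ratio_square_le[OF r(1) \<psi> n2])
      also have "\<dots> \<le> c * ?F"
        unfolding sum_atMost_crossed[OF r(2)] using c r by (intro mult_left_mono) (auto simp: d_def)
      finally show ?thesis using 3 by simp
    qed
  qed auto
  show "(\<Sum>j<r - 1. 1 / (real (n j) - 1)) + (real r - 2)\<^sup>2 / n_tilde r n
      \<le> (real r - 1) / (real (n_min r n) - 1) + (real r - 2)\<^sup>2 / n_tilde r n"
  proof -
    have "1 / (real (n j) - 1) \<le> 1 / (real (n_min r n) - 1)" if "j < r - 1" for j
      using min_le[OF that] assms(5) by (intro divide_left_mono) auto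
    then have "(\<Sum>j<r - 1. 1 / (real (n j) - 1)) \<le> of_nat (card {..<r - 1}) * (1 / (real (n_min r n) - 1))"
      by (intro sum_bounded_above) auto
    then show ?thesis using r by (simp add: of_nat_diff)
  qed
  fix V assume min3: "3 \<le> n_min r n" and V: "contrast_basis (n_total r n) V"
  define b where "b = max (inverse (real (n_min r n) - 2)) (inverse (n_tilde r n - 1))"
  have tilde4: "4 \<le> n_tilde r n"
  proof -
    have "1 + 2 \<le> real (n j)" if "j < r - 1" for j using min_le[OF that] min3 by linarith
    then show ?thesis using n_tilde_ge_square[of 2 r n] r(1) by simp
  qed
  have b: "0 \<le> b" using min3 by (simp add: b_def le_max_iff_disj)
  interpret complete_orthogonal_projections "n_total r n" "{..r}" "crossed_proj r n" by (rule cop)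
  have K: "{..r} = insert r {..r - 1}" "r \<notin> {..r - 1}" using r(2) by auto
  have mean: "crossed_proj r n r = mean_mat (n_total r n)"
    using r(3) by (auto simp: crossed_proj_def effect_proj_def)
  note contrasts = contrasts[OF K mean V N]
  have trace': "mat_trace (transpose_mat V * crossed_proj r n k * V) = d k" if "k \<in> {..r - 1}" for k
    using contrasts(2)[OF that] trace[of k] that by simp
  show "(a_tilde r n V v \<psi>)\<^sup>2 \<le> max (inverse (real (n_min r n) - 2)) (inverse (n_tilde r n - 1))"
    unfolding a_tilde_def A_tilde_def Sigma_tilde_def Sigma_mat_eq_comb[OF r(2)] contrasts(3) b_def[symmetric]
  proof (rule norm_ratio_standardized_le[OF contrasts(1) _ r(2) trace' d pos v \<psi> b])
    fix k assume k: "k \<in> {..r - 1}"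
    \<comment> \<open>Without the mean, multiplicity alone bounds every coefficient.\<close>
    have "1 / d k \<le> b"
    proof (cases "k < r - 1")
      case True
      have "1 / d k \<le> inverse (real (n_min r n) - 2)"
        using True min_le[OF True] min3 by (simp add: d_def inverse_eq_divide) (intro divide_left_mono; simp)
      then show ?thesis by (simp add: b_def)
    next
      case False
      then have "1 / d k \<le> inverse (n_tilde r n - 1)"
        using k tilde4 by (simp add: d_def inverse_eq_divide) (intro divide_left_mono; simp)
      then show ?thesis by (simp add: b_def)
    qed
    then show "(?f k)\<^sup>2 \<le> b * (\<Sum>l\<in>{..r - 1}. (?f l)\<^sup>2 * d l)"
      using k d by (intro square_le_of_weight[of "d k"] member_le_sum) (auto simp: less_imp_le)
  qed auto
qed

end
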